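(* Let $\delta_0$ denote the supremum of all numbers $\delta>0$ with the following property: every function $f\in\mathcal{A}$ satisfying $e^{-\delta/2}<|zf'(z)/f(z)|<e^{\delta/2}$ for all $z\in\mathbb{D}$ is univalent on $\mathbb{D}$. Then $$\frac{\pi}{3}<\delta_0<\frac{5\pi}{7}.$$
   Context: $\mathbb{D}=\{z\in\mathbb{C}:|z|<1\}$. $\mathcal{A}$ denotes the class of analytic functions $f$ on $\mathbb{D}$ normalized by $f(0)=0$, $f'(0)=1$. The value of $zf'(z)/f(z)$ at $z=0$ is understood as $\lim_{z\to0}zf'(z)/f(z)=1$. *)

theory Defs
  imports "HOL-Complex_Analysis.Complex_Analysis"
begin

definition classA :: "(complex \<Rightarrow> complex) \<Rightarrow> bool" where
  "classA f \<longleftrightarrow> f analytic_on ball 0 1 \<and> f 0 = 0 \<and> deriv f 0 = 1"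

text \<open>The quantity z f'(z)/f(z), with its value at z = 0 taken to be the limit 1.\<close>
definition zlogderiv :: "(complex \<Rightarrow> complex) \<Rightarrow> complex \<Rightarrow> complex" where
  "zlogderiv f z = (if z = 0 then 1 else z * deriv f z / f z)"

text \<open>Property of delta: every f in A with exp(-delta/2) < |z f'/f| < exp(delta/2)
  on the disc (in particular z f'/f is defined, i.e. f(z) \<noteq> 0 for z \<noteq> 0)
  is univalent on the disc.\<close>
definition univ_prop :: "real \<Rightarrow> bool" where
  "univ_prop \<delta> \<longleftrightarrow>
     (\<forall>f. classA f \<and>
          (\<forall>z\<in>ball 0 1. (z \<noteq> 0 \<longrightarrow> f z \<noteq> 0) \<and>
               exp (-\<delta>/2) < norm (zlogderiv f z) \<and> norm (zlogderiv f z) < exp (\<delta>/2))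
        \<longrightarrow> inj_on f (ball 0 1))"

definition delta0 :: real where
  "delta0 = Sup {\<delta>. \<delta> > 0 \<and> univ_prop \<delta>}"

end

theory Submission
  imports Defs
begin

text \<open>
  Lower bound: write z f'/f = exp g with g mapping the disc into a vertical strip of width \<open>\<pi> c\<close>.
  The Schwarz--Pick lemma bounds g' and g, and z f''/f' = z g' + exp g - 1 then satisfies
  Becker's condition (1 - |z|^2) |z f''/f'| < 1 for c = 17/50 > 1/3. Becker's criterion is proved by
  a continuity argument along its Loewner chain: a pair of distinct points with equal image can be
  continued to larger times while the points move strictly inwards, but at a maximal time
  (which exists by compactness) this is impossible.

  Upper bound: for z f'/f = ((1 + z)/(1 - z))^(i c) one has f(-cnj z) = -cnj (f z), so f is not injective
  as soon as f takes an imaginary value off the imaginary axis. For c = 57/80 < 5/7 the argument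
  of f exceeds pi/2 at a boundary point with positive real part, near the corner z = 1.
\<close>

subsection \<open>Becker's univalence criterion\<close>

text \<open>Strict bounds on the supremum come from one explicit width on each side: 17 * pi / 50
  exceeds pi / 3 and has the property, 57 * pi / 80 lies below 5 * pi / 7 and lacks it, and the
  property passes to smaller widths. For the lower bound, g and its derivative are estimated
  separately; what this wastes is small enough for 17/50. For the upper bound, p = exp (i c w) maps
  the strip |Im w| < pi / 2 as a covering onto the annulus allowed for z f' / f, which makes it the
  natural candidate. The obstacle is that f is known only through a primitive. With x = c * pi / 2,
  the boundary arguments have derivatives cos (c u) / cosh u up to a sign and a factor exp x or exp
  (- x). The argument on the lower semicircle grows up to U = pi / (2 * c), the first zero of the
  cosine, but the integral over [0, U] is not elementary. Over the whole half-line it is: that the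
  two arguments meet at the corner amounts to the classical value pi / (2 * cosh x). So the integral
  up to U is this value minus a tail, on which 1 / cosh u is close to 2 * exp (- u).\<close>

lemma inj_on_if_deriv_near_const:
  fixes \<phi> :: "'a::real_normed_field \<Rightarrow> 'a"
  assumes "convex S"
    and d: "\<And>z. z \<in> S \<Longrightarrow> (\<phi> has_field_derivative \<phi>' z) (at z within S)"
    and B: "\<And>z. z \<in> S \<Longrightarrow> norm (\<phi>' z - m) \<le> B" and "B < norm m"
  shows "inj_on \<phi> S"
proof (rule inj_onI)
  fix x y assume xy: "x \<in> S" "y \<in> S" "\<phi> x = \<phi> y"
  have "norm ((\<phi> x - m * x) - (\<phi> y - m * y)) \<le> B * norm (x - y)"
    by (rule field_differentiable_bound[OF \<open>convex S\<close> _ B])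
       (use xy in \<open>auto intro!: derivative_eq_intros d\<close>)
  also have "(\<phi> x - m * x) - (\<phi> y - m * y) = m * (y - x)"
    using xy by (simp add: algebra_simps)
  finally have "norm m * norm (x - y) \<le> B * norm (x - y)"
    by (simp add: norm_mult norm_minus_commute)
  with \<open>B < norm m\<close> show "x = y"
    by (metis linorder_not_less mult_less_cancel_right right_minus_eq zero_less_norm_iff)
qed

text \<open>Becker's Loewner chain, reparametrised by \<open>\<tau> = exp (2 t) - 1\<close> and the point \<open>exp (- t) z\<close>. The closed
  disc of radius R at time t becomes the condition \<open>norm z ^ 2 * (1 + \<tau>) \<le> R ^ 2\<close>.\<close>
definition becker_chain :: "(complex \<Rightarrow> complex) \<Rightarrow> real \<Rightarrow> complex \<Rightarrow> complex" where
  "becker_chain f \<tau> z = f z + \<tau> * z * deriv f z"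

definition becker_chain' :: "(complex \<Rightarrow> complex) \<Rightarrow> real \<Rightarrow> complex \<Rightarrow> complex" where
  "becker_chain' f \<tau> z = (1 + \<tau>) * deriv f z + \<tau> * z * deriv (deriv f) z"

lemma becker_chain_0 [simp]: "becker_chain f 0 = f" "becker_chain f \<tau> 0 = f 0"
  by (auto simp: becker_chain_def)

lemma has_field_derivative_becker_chain:
  assumes "f holomorphic_on S" "open S" "z \<in> S"
  shows "(becker_chain f \<tau> has_field_derivative becker_chain' f \<tau> z) (at z within A)"
proof -
  have "(f has_field_derivative deriv f z) (at z)"
       "(deriv f has_field_derivative deriv (deriv f) z) (at z)"
    using assms by (auto intro!: holomorphic_derivI holomorphic_deriv)
  note [derivative_intros] = this[THEN DERIV_subset[OF _ subset_UNIV, of _ _ _ A]]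
  show ?thesis
    unfolding becker_chain_def[abs_def] becker_chain'_def
    by (auto intro!: derivative_eq_intros simp: algebra_simps)
qed

text \<open>The region bound gives \<tau> \<le> (1 + \<tau>) * (1 - |z|^2). This is exactly what
  turns Becker's inequality into domination of the second summand of \<open>becker_chain'\<close> by
  the first.\<close>

lemma becker_chain'_nonzero:
  fixes f :: "complex \<Rightarrow> complex" and z :: complex and \<tau> r :: real
  assumes "deriv f z \<noteq> 0" "\<tau> \<ge> 0" "r \<le> 1" "(norm z)\<^sup>2 * (1 + \<tau>) \<le> r"
    and "(1 - (norm z)\<^sup>2) * norm (z * deriv (deriv f) z) < norm (deriv f z)"
  shows "norm (\<tau> * z * deriv (deriv f) z) < norm ((1 + \<tau>) * deriv f z)"
    and "becker_chain' f \<tau> z \<noteq> 0"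
proof -
  have "\<tau> \<le> (1 + \<tau>) * (1 - (norm z)\<^sup>2)"
    using assms by (auto simp: algebra_simps)
  then have "\<tau> * norm (z * deriv (deriv f) z) \<le> (1 + \<tau>) * ((1 - (norm z)\<^sup>2) * norm (z * deriv (deriv f) z))"
    by (metis mult.assoc mult_right_mono norm_ge_zero)
  also have "\<dots> < (1 + \<tau>) * norm (deriv f z)"
    using assms by (intro mult_strict_left_mono) auto
  finally show *: "norm (\<tau> * z * deriv (deriv f) z) < norm ((1 + \<tau>) * deriv f z)"
    using \<open>\<tau> \<ge> 0\<close> norm_of_real[of "1+\<tau>", where 'a=complex] by (simp add: norm_mult mult.assoc)
  show "becker_chain' f \<tau> z \<noteq> 0"
  proof
    assume "becker_chain' f \<tau> z = 0"
    then have "\<tau> * z * deriv (deriv f) z = - ((1 + \<tau>) * deriv f z)"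
      by (simp add: becker_chain'_def eq_neg_iff_add_eq_0 add.commute)
    from arg_cong[OF this, of norm] show False using * by simp
  qed
qed

text \<open>The equation defining the continuation is linear in the time parameter, so the time is a
  holomorphic function of the point, and the trajectory is its local inverse.\<close>
lemma becker_chain_continuation:
  fixes f :: "complex \<Rightarrow> complex" and z :: complex and \<tau> r e :: real
  assumes holf: "f holomorphic_on ball 0 1" and f': "\<And>z. norm z < 1 \<Longrightarrow> deriv f z \<noteq> 0"
    and beck: "\<And>z. norm z < 1 \<Longrightarrow> (1 - (norm z)\<^sup>2) * norm (z * deriv (deriv f) z) < norm (deriv f z)"
    and \<tau>: "\<tau> \<ge> 0" and r: "r < 1" and z: "(norm z)\<^sup>2 * (1 + \<tau>) \<le> r"
    and "e > 0"
  shows "eventually (\<lambda>s. \<exists>w. dist w z < e \<and> becker_chain f s w = becker_chain f \<tau> z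
            \<and> (norm w)\<^sup>2 * (1 + s) \<le> r) (at_right \<tau>)"
proof (cases "z = 0")
  \<comment> \<open>The origin stays fixed, since the chain has the value f 0 there at every time.
    It is treated apart because the time function \<open>\<theta>\<close> below divides by
    w.\<close>
  case True
  then show ?thesis using z \<open>e > 0\<close>
    by (intro always_eventually) (auto intro!: exI[of _ 0])
next
  case False
  define U where "U = ball (0::complex) 1 - {0}"
  have [simp]: "open U" unfolding U_def by auto
  have "(norm z)\<^sup>2 \<le> (norm z)\<^sup>2 * (1 + \<tau>)"
    using \<tau> by (simp add: algebra_simps)
  then have nz: "norm z < 1"
    using z r by (smt (verit) one_le_power)
  have zU: "z \<in> U" using nz False by (auto simp: U_def)
  define \<theta> where "\<theta> w = (becker_chain f \<tau> z - f w) / (w * deriv f w)" for w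
  have hol\<theta>: "\<theta> holomorphic_on U"
    unfolding \<theta>_def U_def using f'
    by (intro holomorphic_intros holomorphic_on_subset[OF holf] holomorphic_deriv
       holomorphic_on_subset[OF holomorphic_deriv[OF holf]]) auto
  have \<theta>z: "\<theta> z = \<tau>"
    using zU f' by (auto simp: \<theta>_def becker_chain_def U_def)
  have chain_eq: "becker_chain f s w = becker_chain f \<tau> z" if "w \<in> U" "\<theta> w = of_real s" for w s
    using that f'[of w] unfolding becker_chain_def[of f s] \<theta>_def U_def by (auto simp: field_simps)
  have d\<theta>: "deriv \<theta> z = - becker_chain' f \<tau> z / (z * deriv f z)"
  proof -
    have "(f has_field_derivative deriv f z) (at z)"
       "(deriv f has_field_derivative deriv (deriv f) z) (at z)"
      using holf nz by (auto intro!: holomorphic_derivI holomorphic_deriv)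
    note [derivative_intros] = this
    have "(\<theta> has_field_derivative - becker_chain' f \<tau> z / (z * deriv f z)) (at z)"
      unfolding \<theta>_def[abs_def]
      apply (rule derivative_eq_intros refl)+
      using f'[OF nz] False
      by (auto simp: becker_chain_def becker_chain'_def field_simps)
    then show ?thesis by (rule DERIV_imp_deriv)
  qed
  have bnz: "becker_chain' f \<tau> z \<noteq> 0"
    and small: "norm (\<tau> * z * deriv (deriv f) z) < norm ((1 + \<tau>) * deriv f z)"
    using becker_chain'_nonzero[OF f'[OF nz] \<tau> _ z beck[OF nz]] r by auto
  have d\<theta>0: "deriv \<theta> z \<noteq> 0"
    using d\<theta> bnz zU f' by (auto simp: U_def)
  obtain \<rho> where \<rho>: "\<rho> > 0" "ball z \<rho> \<subseteq> U" "inj_on \<theta> (ball z \<rho>)"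
    using has_complex_derivative_locally_injective[OF hol\<theta> zU \<open>open U\<close> d\<theta>0] by blast
  define V where "V = ball z (min \<rho> e)"
  have V: "open V" "z \<in> V" "V \<subseteq> U" "inj_on \<theta> V"
    using \<rho> \<open>e > 0\<close> unfolding V_def by (auto intro: inj_on_subset)
  have hol\<theta>V: "\<theta> holomorphic_on V" using hol\<theta> V(3) by (rule holomorphic_on_subset)
  obtain g where g: "g holomorphic_on \<theta> ` V"
    "\<And>w. w \<in> V \<Longrightarrow> deriv \<theta> w * deriv g (\<theta> w) = 1" "\<And>w. w \<in> V \<Longrightarrow> g (\<theta> w) = w"
    using holomorphic_has_inverse[OF hol\<theta>V V(1,4)] by metis
  have oV: "open (\<theta> ` V)"
    using open_mapping_thm3[OF hol\<theta>V V(1,4)] .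
  have "(g has_field_derivative deriv g (\<theta> z)) (at (\<theta> z))"
    using V by (intro holomorphic_derivI[OF g(1) oV]) auto
  also have "deriv g (\<theta> z) = 1 / deriv \<theta> z"
    using g(2)[OF V(2)] d\<theta>0 by (simp add: field_simps)
  finally have dg: "(g has_field_derivative 1 / deriv \<theta> z) (at (of_real \<tau>))"
    by (simp add: \<theta>z)
  have gz: "g (of_real \<tau>) = z" using g(3)[OF V(2)] by (simp add: \<theta>z)
  define \<gamma> where "\<gamma> s = g (of_real s)" for s :: real
  have d\<gamma>: "(\<gamma> has_vector_derivative 1 / deriv \<theta> z) (at \<tau>)"
    unfolding \<gamma>_def[abs_def] using has_vector_derivative_real_field[OF dg] by (simp add: o_def)
  define q where "q = 1 / deriv \<theta> z"
  \<comment> \<open>In Becker's original coordinate exp t * w this is the squared modulus of the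
    moving point, so a decreasing \<open>N\<close> means strict inward motion; \<open>q\<close> is
    the velocity of the trajectory at \<tau>.\<close>
  define N where "N s = (\<gamma> s \<bullet> \<gamma> s) * (1 + s)" for s
  have \<gamma>\<tau>: "\<gamma> \<tau> = z" by (simp add: \<gamma>_def gz)
  have d\<gamma>': "(\<gamma> has_derivative (\<lambda>x. x *\<^sub>R q)) (at \<tau>)"
    using d\<gamma> by (simp add: has_vector_derivative_def q_def)
  have dN: "(N has_real_derivative 2 * (z \<bullet> q) * (1 + \<tau>) + z \<bullet> z) (at \<tau>)"
    unfolding N_def[abs_def] has_field_derivative_def
    by (rule has_derivative_eq_rhs, (rule derivative_intros d\<gamma>')+)
       (auto simp: fun_eq_iff \<gamma>\<tau> algebra_simps inner_commute)
  \<comment> \<open>Since (1 + \<tau>) * q = - z * A / (A + B), the derivative of \<open>N\<close>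
    equals |z|^2 * (1 - 2 * Re (A / (A + B))). The real part exceeds 1/2 precisely because |B| <
    |A|.\<close>
  have neg: "2 * (z \<bullet> q) * (1 + \<tau>) + z \<bullet> z < 0"
  proof -
    define A where "A = (1 + \<tau>) * deriv f z"
    define B where "B = \<tau> * z * deriv (deriv f) z"
    have AB: "norm B < norm A" "A + B \<noteq> 0"
      using small bnz by (auto simp: A_def B_def becker_chain'_def)
    have q: "(1 + \<tau>) * q = - z * (A / (A + B))"
    proof -
      have "q = - (z * deriv f z / becker_chain' f \<tau> z)"
        by (simp add: q_def d\<theta>)
      also have "becker_chain' f \<tau> z = A + B"
        by (simp add: becker_chain'_def A_def B_def)
      finally show ?thesis by (simp add: A_def)
    qed
    have "norm (A + B) ^ 2 = norm A ^ 2 + 2 * (A \<bullet> B) + norm B ^ 2"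
      by (simp add: power2_norm_eq_inner algebra_simps inner_commute)
    moreover have "norm B ^ 2 < norm A ^ 2" using AB by (simp add: power_strict_mono)
    ultimately have *: "norm (A + B) ^ 2 < 2 * (A \<bullet> (A + B))"
      by (simp add: inner_add_right power2_norm_eq_inner)
    have "Re (A / (A + B)) = (A \<bullet> (A + B)) / norm (A + B) ^ 2"
      by (simp add: Re_divide cmod_power2 inner_complex_def)
    moreover have "1 < 2 * (A \<bullet> (A + B)) / norm (A + B) ^ 2"
      using * AB(2) by (simp add: less_divide_eq)
    ultimately have half: "2 * Re (A / (A + B)) > 1" by simp
    have "(z \<bullet> q) * (1 + \<tau>) = z \<bullet> ((1 + \<tau>) * q)"
      using inner_scaleR_right[of z "1+\<tau>" q] by (simp add: scaleR_conv_of_real)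
    also have "\<dots> = - (z \<bullet> z) * Re (A / (A + B))"
    proof -
      have "z \<bullet> (- z * c) = - (z \<bullet> z) * Re c" for c
        by (simp add: inner_complex_def algebra_simps)
      then show ?thesis unfolding q by blast
    qed
    finally have "2 * (z \<bullet> q) * (1 + \<tau>) + z \<bullet> z = (z \<bullet> z) * (1 - 2 * Re (A / (A + B)))"
      by (simp add: algebra_simps)
    also have "\<dots> < 0"
      using half False by (intro mult_pos_neg) auto
    finally show ?thesis .
  qed
  obtain d where d: "d > 0" "\<And>h. 0 < h \<Longrightarrow> h < d \<Longrightarrow> N (\<tau> + h) < N \<tau>"
    using DERIV_neg_dec_right[OF dN neg] by blast
  have "eventually (\<lambda>s. N s < N \<tau>) (at_right \<tau>)"
    unfolding eventually_at_right_field
    using d(1) d(2)[of "s - \<tau>" for s] by (intro exI[of _ "\<tau> + d"]) auto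
  moreover have "eventually (\<lambda>s. of_real s \<in> \<theta> ` V) (at_right \<tau>)"
  proof -
    have "((\<lambda>s. of_real s) \<longlongrightarrow> (of_real \<tau> :: complex)) (at_right \<tau>)"
      by (intro tendsto_intros)
    then show ?thesis
      using oV V(2) \<theta>z by (auto elim!: topological_tendstoD intro!: image_eqI[of _ _ z])
  qed
  ultimately show ?thesis
  proof eventually_elim
    case (elim s)
    then obtain w where w: "w \<in> V" "\<theta> w = of_real s" by auto
    have \<gamma>w: "\<gamma> s = w" using g(3)[OF w(1)] w(2) by (simp add: \<gamma>_def)
    have "N s \<le> r"
      using elim(1) z by (simp add: N_def \<gamma>_def gz power2_norm_eq_inner)
    then show ?case
      using w chain_eq[of w s] V(3) \<gamma>w
      by (intro exI[of _ w]) (auto simp: N_def power2_norm_eq_inner V_def dist_commute)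
  qed
qed


theorem becker_univalence_criterion:
  fixes f :: "complex \<Rightarrow> complex"
  assumes holf: "f holomorphic_on ball 0 1" and f': "\<And>z. norm z < 1 \<Longrightarrow> deriv f z \<noteq> 0"
    and beck: "\<And>z. norm z < 1 \<Longrightarrow> (1 - (norm z)\<^sup>2) * norm (z * deriv (deriv f) z) < norm (deriv f z)"
  shows "inj_on f (ball 0 1)"
proof (rule inj_onI, rule ccontr)
  fix a b :: complex assume ab: "a \<in> ball 0 1" "b \<in> ball 0 1" "f a = f b" "a \<noteq> b"
  define r where "r = max ((norm a)\<^sup>2) ((norm b)\<^sup>2)"
  have r: "r < 1" "r \<ge> 0" "(norm a)\<^sup>2 \<le> r" "(norm b)\<^sup>2 \<le> r"
    using ab by (auto simp: r_def power_less_one_iff le_max_iff_disj)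
  have cont: "continuous_on (ball 0 1) f" "continuous_on (ball 0 1) (deriv f)"
       "continuous_on (ball 0 1) (deriv (deriv f))"
    using holf by (auto intro!: holomorphic_on_imp_continuous_on holomorphic_deriv)
  have cont': "continuous_on (UNIV \<times> ball 0 1) (\<lambda>p. becker_chain f (fst p) (snd p))"
       "continuous_on (UNIV \<times> ball 0 1) (\<lambda>p. becker_chain' f (fst p) (snd p))"
    unfolding becker_chain_def becker_chain'_def
    by (auto intro!: continuous_intros continuous_on_compose2[OF cont(1)]
         continuous_on_compose2[OF cont(2)] continuous_on_compose2[OF cont(3)])
  have in_disc: "norm z < 1" if "(norm z)\<^sup>2 * (1 + \<tau>) \<le> r" "\<tau> \<ge> 0" for \<tau> :: real and z :: complex
  proof -
    have "(norm z)\<^sup>2 \<le> (norm z)\<^sup>2 * (1 + \<tau>)" using that by (simp add: algebra_simps)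
    then show ?thesis using that r by (smt (verit) one_le_power)
  qed
  \<comment> \<open>One radius serves all nearby times. This is what makes the collision set
    \<open>X\<close> closed: the condition z \<noteq> w is not closed by itself, but colliding
    points cannot merge in a limit.\<close>
  have locinj: "\<exists>e>0. \<forall>s. dist s \<tau> < e \<longrightarrow> inj_on (becker_chain f s) (ball z e)"
    if z: "(norm z)\<^sup>2 * (1 + \<tau>) \<le> r" "\<tau> \<ge> 0" for \<tau> :: real and z
  proof -
    define m where "m = becker_chain' f \<tau> z"
    have nz: "norm z < 1" using in_disc that by blast
    have m: "m \<noteq> 0"
      unfolding m_def using becker_chain'_nonzero(2)[OF f'[OF nz] z(2) _ z(1) beck[OF nz]] r by simp
    have "isCont (\<lambda>p. becker_chain' f (fst p) (snd p)) (\<tau>, z)"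
      using cont'(2) nz by (subst (asm) continuous_on_eq_continuous_at) (auto simp: open_Times)
    then obtain d where d: "d > 0" "\<And>p. dist p (\<tau>, z) < d \<Longrightarrow> dist (becker_chain' f (fst p) (snd p)) m < norm m / 2"
      using m unfolding continuous_at_eps_delta m_def by (metis fst_conv half_gt_zero snd_conv zero_less_norm_iff)
    define e where "e = min (d/2) (1 - norm z)"
    have e: "e > 0" using d nz by (auto simp: e_def)
    have "inj_on (becker_chain f s) (ball z e)" if s: "dist s \<tau> < e" for s
    proof (rule inj_on_if_deriv_near_const[where m = m and B = "norm m / 2" and \<phi>' = "becker_chain' f s"])
      fix u assume u: "u \<in> ball z e"
      have "norm u \<le> norm z + dist z u" by (metis dist_norm norm_triangle_sub add.commute norm_minus_commute)
      then have nu: "norm u < 1" using u by (auto simp: e_def)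
      then show "(becker_chain f s has_field_derivative becker_chain' f s u) (at u within ball z e)"
        by (intro has_field_derivative_becker_chain[OF holf]) auto
      have "dist (s, u) (\<tau>, z) \<le> dist s \<tau> + dist u z"
        by (simp add: dist_Pair_Pair sqrt_sum_squares_le_sum)
      also have "\<dots> < d" using s u by (auto simp: e_def dist_commute)
      finally show "norm (becker_chain' f s u - m) \<le> norm m / 2"
        using d(2)[of "(s,u)"] by (simp add: dist_norm)
    qed (use m in auto)
    then show ?thesis using e by blast
  qed
  \<comment> \<open>This bounds the times in \<open>X\<close>: at large \<tau> the region constraint
    squeezes both points into ball 0 \<eta>. The radius does not depend on \<tau> because 1 + \<tau>
    is a common factor of the comparison derivative and of the deviation from it.\<close>
  obtain \<eta> where \<eta>: "\<eta> > 0" "\<And>\<tau>. \<tau> \<ge> 0 \<Longrightarrow> inj_on (becker_chain f \<tau>) (ball 0 \<eta>)"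
  proof -
    define m where "m = deriv f 0"
    have m: "m \<noteq> 0" using f' by (simp add: m_def)
    have "isCont (\<lambda>u. norm (deriv f u - m) + norm (u * deriv (deriv f) u)) 0"
      using cont(2,3) by (intro continuous_intros) (simp_all add: continuous_on_eq_continuous_at)
    then obtain d where d: "d > 0" "\<And>u. dist u 0 < d \<Longrightarrow>
        dist (norm (deriv f u - m) + norm (u * deriv (deriv f) u)) 0 < norm m / 2"
      using m unfolding continuous_at_eps_delta m_def
      by (metis (no_types, lifting) add.right_neutral cancel_comm_monoid_add_class.diff_cancel half_gt_zero mult_zero_left norm_zero zero_less_norm_iff)
    define e where "e = min d 1"
    have "inj_on (becker_chain f \<tau>) (ball 0 e)" if \<tau>: "\<tau> \<ge> 0" for \<tau> :: real
    proof (rule inj_on_if_deriv_near_const[where m = "of_real (1+\<tau>) * m" and B = "(1+\<tau>) * (norm m / 2)" and \<phi>' = "becker_chain' f \<tau>"])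
      fix u :: complex assume u: "u \<in> ball 0 e"
      then show "(becker_chain f \<tau> has_field_derivative becker_chain' f \<tau> u) (at u within ball 0 e)"
        by (intro has_field_derivative_becker_chain[OF holf]) (auto simp: e_def)
      have "norm (becker_chain' f \<tau> u - of_real (1+\<tau>) * m)
          = norm (of_real (1+\<tau>) * (deriv f u - m) + of_real \<tau> * (u * deriv (deriv f) u))"
        by (simp add: becker_chain'_def algebra_simps)
      also have "\<dots> \<le> (1+\<tau>) * norm (deriv f u - m) + \<tau> * norm (u * deriv (deriv f) u)"
        using \<tau> by (intro order.trans[OF norm_triangle_ineq]) (simp add: norm_mult del: of_real_add)
      also have "\<dots> \<le> (1+\<tau>) * norm (deriv f u - m) + (1+\<tau>) * norm (u * deriv (deriv f) u)"
        by (intro add_left_mono mult_right_mono) auto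
      also have "\<dots> = (1+\<tau>) * (norm (deriv f u - m) + norm (u * deriv (deriv f) u))"
        by (simp add: algebra_simps)
      also have "\<dots> \<le> (1+\<tau>) * (norm m / 2)"
        using d(2)[of u] u \<tau> by (intro mult_left_mono) (auto simp: e_def)
      finally show "norm (becker_chain' f \<tau> u - of_real (1+\<tau>) * m) \<le> (1+\<tau>) * (norm m / 2)" .
    next
      show "(1+\<tau>) * (norm m / 2) < norm (of_real (1+\<tau>) * m)"
        using m \<tau> by (simp add: norm_mult del: of_real_add)
    qed auto
    moreover have "e > 0" using d by (simp add: e_def)
    ultimately show ?thesis using that by blast
  qed
  \<comment> \<open>All collisions in the shrinking region, with their times. A counterexample to
    injectivity of f is an element at time 0, and a latest element will be contradicted.\<close>
  define X where "X = {(\<tau>, z, w). 0 \<le> \<tau> \<and> (norm z)\<^sup>2 * (1 + \<tau>) \<le> r \<and> (norm w)\<^sup>2 * (1 + \<tau>) \<le> r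
       \<and> z \<noteq> w \<and> becker_chain f \<tau> z = becker_chain f \<tau> w}"
  have bound: "\<tau> \<le> r / \<eta>\<^sup>2" if "(\<tau>, z, w) \<in> X" for \<tau> z w
  proof (rule ccontr)
    assume "\<not> \<tau> \<le> r / \<eta>\<^sup>2"
    then have *: "r < \<eta>\<^sup>2 * (1 + \<tau>)" using \<eta>(1) by (simp add: field_simps) (smt (verit) zero_less_power)
    have "norm u < \<eta>" if "(norm u)\<^sup>2 * (1 + \<tau>) \<le> r" "\<tau> \<ge> 0" for u :: complex
    proof -
      have "(norm u)\<^sup>2 * (1 + \<tau>) < \<eta>\<^sup>2 * (1 + \<tau>)" using * that by linarith
      then show ?thesis using \<eta>(1) that(2) by (simp add: power_less_imp_less_base)
    qed
    then have "z \<in> ball 0 \<eta>" "w \<in> ball 0 \<eta>" using that by (auto simp: X_def)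
    then show False using \<eta>(2)[of \<tau>] that by (auto simp: X_def dest: inj_onD)
  qed
  have "bounded X"
  proof (rule bounded_subset)
    show "bounded ({0..r/\<eta>\<^sup>2} \<times> cball (0::complex) 1 \<times> cball (0::complex) 1)"
      by (intro bounded_Times) auto
    show "X \<subseteq> {0..r/\<eta>\<^sup>2} \<times> cball 0 1 \<times> cball 0 1"
      using bound in_disc by (fastforce simp: X_def)
  qed
  moreover have "closed X"
    unfolding closed_sequential_limits
  proof safe
    fix x \<tau> z w assume x: "\<forall>n. x n \<in> X" "x \<longlonglongrightarrow> (\<tau>, z, w)"
    define t where "t n = fst (x n)" for n
    define u where "u n = fst (snd (x n))" for n
    define v where "v n = snd (snd (x n))" for n
    have xn: "t n \<ge> 0" "(norm (u n))\<^sup>2 * (1 + t n) \<le> r" "(norm (v n))\<^sup>2 * (1 + t n) \<le> r"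
       "u n \<noteq> v n" "becker_chain f (t n) (u n) = becker_chain f (t n) (v n)" for n
      using x(1)[rule_format, of n] by (auto simp: X_def t_def u_def v_def)
    have lim: "t \<longlonglongrightarrow> \<tau>" "u \<longlonglongrightarrow> z" "v \<longlonglongrightarrow> w"
      unfolding t_def u_def v_def
      using tendsto_fst[OF x(2)] tendsto_fst[OF tendsto_snd[OF x(2)]] tendsto_snd[OF tendsto_snd[OF x(2)]] by simp_all
    have \<tau>0: "\<tau> \<ge> 0" using lim(1) xn(1) by (simp add: LIMSEQ_le_const)
    have zr: "(norm z)\<^sup>2 * (1 + \<tau>) \<le> r"
      by (rule LIMSEQ_le_const2[of "\<lambda>n. (norm (u n))\<^sup>2 * (1 + t n)"]) (use xn(2) in \<open>auto intro!: tendsto_intros lim\<close>)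
    have wr: "(norm w)\<^sup>2 * (1 + \<tau>) \<le> r"
      by (rule LIMSEQ_le_const2[of "\<lambda>n. (norm (v n))\<^sup>2 * (1 + t n)"]) (use xn(3) in \<open>auto intro!: tendsto_intros lim\<close>)
    have chlim: "(\<lambda>n. becker_chain f (t n) (y n)) \<longlonglongrightarrow> becker_chain f \<tau> y0"
      if "y \<longlonglongrightarrow> y0" "norm y0 < 1" for y y0
    proof -
      have "isCont (\<lambda>p. becker_chain f (fst p) (snd p)) (\<tau>, y0)"
        using cont'(1) that(2) by (subst (asm) continuous_on_eq_continuous_at) (auto simp: open_Times)
      from isCont_tendsto_compose[OF this, of "\<lambda>n. (t n, y n)"] show ?thesis
        using tendsto_Pair[OF lim(1) that(1)] by simp
    qed
    have eq: "becker_chain f \<tau> z = becker_chain f \<tau> w"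
      using LIMSEQ_unique[OF chlim[OF lim(2) in_disc[OF zr \<tau>0]]] chlim[OF lim(3) in_disc[OF wr \<tau>0]] xn(5) by simp
    have "z \<noteq> w"
    proof
      assume [simp]: "z = w"
      obtain e where e: "e > 0" "\<And>s. dist s \<tau> < e \<Longrightarrow> inj_on (becker_chain f s) (ball z e)"
        using locinj[OF zr \<tau>0] by blast
      have "eventually (\<lambda>n. dist (t n) \<tau> < e \<and> dist (u n) z < e \<and> dist (v n) z < e) sequentially"
        using lim e(1) by (intro eventually_conj) (auto dest: tendstoD)
      then obtain n where "dist (t n) \<tau> < e" "dist (u n) z < e" "dist (v n) z < e"
        by (auto simp: eventually_sequentially)
      with e(2)[of "t n"] xn(4,5)[of n] show False
        by (auto simp: inj_on_def dist_commute)
    qed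
    then show "(\<tau>, z, w) \<in> X" using \<tau>0 zr wr eq by (auto simp: X_def)
  qed
  ultimately have "compact X" by (simp add: compact_eq_bounded_closed)
  moreover have "(0, a, b) \<in> X" using ab r by (auto simp: X_def)
  ultimately obtain p where p: "p \<in> X" "\<forall>q\<in>X. fst q \<le> fst p"
    using continuous_attains_sup[of X fst] continuous_on_fst[OF continuous_on_id, of X] by blast
  obtain \<tau> z w where p_eq: "p = (\<tau>, z, w)" by (cases p)
  have X: "0 \<le> \<tau>" "(norm z)\<^sup>2 * (1 + \<tau>) \<le> r" "(norm w)\<^sup>2 * (1 + \<tau>) \<le> r"
       "z \<noteq> w" "becker_chain f \<tau> z = becker_chain f \<tau> w"
    using p(1) by (auto simp: p_eq X_def)
  \<comment> \<open>Moving each point by less than half of their distance keeps the continued points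
    distinct.\<close>
  define e where "e = dist z w / 2"
  have e: "e > 0" using X(4) by (simp add: e_def)
  have "eventually (\<lambda>s. s > \<tau>) (at_right \<tau>)" by (simp add: eventually_at_right_less)
  moreover have "eventually (\<lambda>s. \<exists>u'. dist u' u < e \<and> becker_chain f s u' = becker_chain f \<tau> u
            \<and> (norm u')\<^sup>2 * (1 + s) \<le> r) (at_right \<tau>)" if "u \<in> {z, w}" for u
    using becker_chain_continuation[OF holf _ _ X(1) r(1) _ e, of u] f' beck X(2,3) that by blast
  from this[of z] this[of w]
  have "eventually (\<lambda>s. \<exists>u'. dist u' z < e \<and> becker_chain f s u' = becker_chain f \<tau> z
            \<and> (norm u')\<^sup>2 * (1 + s) \<le> r) (at_right \<tau>)"
       "eventually (\<lambda>s. \<exists>u'. dist u' w < e \<and> becker_chain f s u' = becker_chain f \<tau> w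
            \<and> (norm u')\<^sup>2 * (1 + s) \<le> r) (at_right \<tau>)"
    by auto
  ultimately
  have "eventually (\<lambda>s. \<exists>z' w'. (s, z', w') \<in> X \<and> s > \<tau>) (at_right \<tau>)"
  proof eventually_elim
    case (elim s)
    then obtain z' w' where zw: "dist z' z < e" "dist w' w < e" "becker_chain f s z' = becker_chain f s w'"
      "(norm z')\<^sup>2 * (1 + s) \<le> r" "(norm w')\<^sup>2 * (1 + s) \<le> r"
      using X(5) by metis
    have "z' \<noteq> w'"
      using zw(1,2) dist_triangle_half_r[of z' z "2*e" w] by (auto simp: e_def dist_commute)
    then show ?case using zw elim X(1) by (intro exI[of _ z'] exI[of _ w']) (auto simp: X_def)
  qed
  then obtain s z' w' where "(s, z', w') \<in> X" "s > \<tau>"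
    using eventually_happens'[OF trivial_limit_at_right_real] by blast
  then show False using p(2) by (auto simp: p_eq)
qed

subsection \<open>The lower bound\<close>

text \<open>The disc automorphism \<open>T\<close> moves 0 to z with derivative 1 - |z|^2 at 0, and
  a Cayley map sends the half-plane to the disc and q z to 0. The Schwarz lemma for the composition
  \<open>k\<close> gives the bound.\<close>

lemma Schwarz_Pick_half_plane:
  assumes hol: "q holomorphic_on ball 0 1" and pos: "\<And>z. norm z < 1 \<Longrightarrow> Re (q z) > 0"
    and z: "norm z < 1"
  shows "(1 - (norm z)\<^sup>2) * norm (deriv q z) \<le> 2 * Re (q z)"
proof -
  define T where "T w = (w + z) / (1 + cnj z * w)" for w
  have den: "1 + cnj z * w \<noteq> 0" if "norm w < 1" for w
  proof
    assume "1 + cnj z * w = 0"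
    then have "cnj z * w = - 1" by (simp add: eq_neg_iff_add_eq_0 add.commute)
    then have "norm z * norm w = 1" by (metis complex_mod_cnj norm_minus_cancel norm_mult norm_one)
    then show False using z that by (metis mult_less_cancel_left2 mult_strict_mono' norm_ge_zero order_less_irrefl mult_1)
  qed
  have T1: "norm (T w) < 1" if "norm w < 1" for w
    using Moebius_function_norm_lt_1[of "- z" w 0] z that
    by (simp add: Moebius_function_def T_def)
  define m where "m = 1 - (norm z)\<^sup>2"
  have m: "m > 0" using z by (simp add: m_def power_less_one_iff)
  have dT: "(T has_field_derivative of_real m) (at 0)"
    unfolding T_def[abs_def] m_def
    by (rule derivative_eq_intros refl)+ (auto simp: complex_mult_cnj cmod_power2 simp flip: of_real_power)
  define k where "k w = (q (T w) - q z) / (q (T w) + cnj (q z))" for w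
  have kden: "q (T w) + cnj (q z) \<noteq> 0" if "norm w < 1" for w
    using pos[OF T1[OF that]] pos[OF z] by (auto simp: complex_eq_iff)
  have holT: "T holomorphic_on ball 0 1"
    unfolding T_def using den by (auto intro!: holomorphic_intros)
  have holk: "k holomorphic_on ball 0 1"
    unfolding k_def using kden T1
    by (auto intro!: holomorphic_intros holomorphic_on_compose_gen[OF holT hol, unfolded o_def])
  have [simp]: "T 0 = z" by (simp add: T_def)
  have k1: "norm (k w) < 1" if "norm w < 1" for w
  proof -
    have "(norm (q (T w) - q z))\<^sup>2 < (norm (q (T w) + cnj (q z)))\<^sup>2"
      using mult_pos_pos[OF pos[OF T1[OF that]] pos[OF z]]
      unfolding cmod_power2 by (simp add: power2_eq_square algebra_simps)
    then have "norm (q (T w) - q z) < norm (q (T w) + cnj (q z))"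
      by (rule power_less_imp_less_base) simp
    then show ?thesis using kden[OF that] by (simp add: k_def norm_divide)
  qed
  have qT: "((\<lambda>w. q (T w)) has_field_derivative deriv q z * of_real m) (at 0)"
    using hol z by (intro DERIV_chain2[OF _ dT]) (auto intro!: holomorphic_derivI)
  have "(k has_field_derivative deriv q z * of_real m / of_real (2 * Re (q z))) (at 0)"
  proof -
    have "q z + cnj (q z) = of_real (2 * Re (q z))" by (rule complex_add_cnj)
    then show ?thesis
      unfolding k_def[abs_def] using kden[of 0]
      by - (rule derivative_eq_intros qT refl | simp add: field_simps)+
  qed
  then have "deriv k 0 = deriv q z * of_real m / of_real (2 * Re (q z))"
    by (rule DERIV_imp_deriv)
  moreover have "norm (deriv k 0) \<le> 1"
    by (rule Schwarz_Lemma(2)[OF holk _ k1, of 0]) (auto simp: k_def)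
  ultimately have "norm (deriv q z) * \<bar>m\<bar> / (2 * Re (q z)) \<le> 1"
    using pos[OF z] by (simp add: norm_divide norm_mult)
  then have "norm (deriv q z) * m \<le> 2 * Re (q z)"
    using pos[OF z] m by (simp add: field_simps)
  then show ?thesis by (simp add: m_def mult.commute)
qed

text \<open>The map exp (i g / c) carries the strip to the right half-plane. Its derivative has
  modulus |q| * |g'| / c, so after weakening Re q to |q| the factor |q| cancels and a bound
  independent of g z remains.\<close>

lemma Schwarz_Pick_strip:
  fixes c :: real
  assumes hol: "g holomorphic_on ball 0 1" and "c > 0"
    and strip: "\<And>z. norm z < 1 \<Longrightarrow> \<bar>Re (g z)\<bar> < c * pi / 2" and z: "norm z < 1"
  shows "(1 - (norm z)\<^sup>2) * norm (deriv g z) \<le> 2 * c"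
proof -
  define q where "q w = exp (\<i> * g w / c)" for w
  have holq: "q holomorphic_on ball 0 1"
    unfolding q_def using hol \<open>c > 0\<close> by (auto intro!: holomorphic_intros)
  have pos: "Re (q w) > 0" if "norm w < 1" for w
  proof -
    have "\<bar>Re (g w) / c\<bar> < pi / 2"
      using strip[OF that] \<open>c > 0\<close> by (simp add: field_simps)
    then have "cos (Re (g w) / c) > 0" by (intro cos_gt_zero_pi) linarith+
    then show ?thesis by (simp add: q_def Re_exp)
  qed
  have "(g has_field_derivative deriv g z) (at z)"
    using hol z by (auto intro!: holomorphic_derivI)
  then have "(q has_field_derivative q z * (\<i> * deriv g z / c)) (at z)"
    unfolding q_def[abs_def] using \<open>c > 0\<close> by (auto intro!: derivative_eq_intros)
  then have dq: "deriv q z = q z * (\<i> * deriv g z / c)" by (rule DERIV_imp_deriv)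
  have "(1 - (norm z)\<^sup>2) * norm (deriv q z) \<le> 2 * Re (q z)"
    by (rule Schwarz_Pick_half_plane[OF holq pos z])
  also have "\<dots> \<le> 2 * norm (q z)" using complex_Re_le_cmod[of "q z"] by simp
  finally have "norm (q z) * ((1 - (norm z)\<^sup>2) * norm (deriv g z) / c) \<le> norm (q z) * 2"
    using \<open>c > 0\<close> by (simp add: dq norm_mult norm_divide field_simps)
  then have "(1 - (norm z)\<^sup>2) * norm (deriv g z) / c \<le> 2"
    by (subst (asm) mult_le_cancel_left_pos) (auto simp: q_def)
  then show ?thesis using \<open>c > 0\<close> by (simp add: field_simps)
qed

text \<open>Integration along the radius from 0, where 2 * c / (1 - t^2) has the primitive c * ln
  ((1 + t) / (1 - t)).\<close>

lemma norm_le_if_Bloch_bound: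
  assumes hol: "g holomorphic_on ball 0 1" and "g 0 = 0"
    and bd: "\<And>z. norm z < 1 \<Longrightarrow> (1 - (norm z)\<^sup>2) * norm (deriv g z) \<le> 2 * c" and z: "norm z < 1"
  shows "norm (g z) \<le> c * ln ((1 + norm z) / (1 - norm z))"
proof (cases "z = 0")
  case True
  then show ?thesis using \<open>g 0 = 0\<close> by simp
next
  case False
  define L where "L t = c * (ln (1 + t) - ln (1 - t))" for t
  have "norm (g (of_real 1 * z) - g (of_real 0 * z)) \<le> L (1 * norm z) - L (0 * norm z)"
  proof (rule differentiable_bound_general[where f' = "\<lambda>t. z * deriv g (of_real t * z)" and \<phi>' = "\<lambda>t. 2 * c * norm z / (1 - (t * norm z)\<^sup>2)"])
    have tz: "norm (of_real t * z) < 1" if "0 \<le> t" "t \<le> 1" for t :: real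
      using that z by (simp add: norm_mult) (smt (verit) mult_left_le_one_le norm_ge_zero)
    fix t :: real assume t: "0 < t" "t < 1"
    have tn: "t * norm z < 1" "t * norm z \<ge> 0" using tz[of t] t by (auto simp: norm_mult)
    have "(g has_field_derivative deriv g (of_real t * z)) (at (of_real t * z))"
      using hol tz[of t] t by (auto intro!: holomorphic_derivI)
    moreover have "((\<lambda>t. of_real t * z) has_vector_derivative z) (at t)"
      by (auto intro!: derivative_eq_intros)
    ultimately show "((\<lambda>t. g (of_real t * z)) has_vector_derivative z * deriv g (of_real t * z)) (at t)"
      using field_vector_diff_chain_at[of "\<lambda>t. of_real t * z" z t g] by (simp add: o_def)
    have "1 / (1 + x) + 1 / (1 - x) = 2 / (1 - x\<^sup>2)" if "0 \<le> x" "x < 1" for x :: real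
      using that by (simp add: field_simps power2_eq_square)
    from this[OF tn(2,1)]
    show "((\<lambda>t. L (t * norm z)) has_vector_derivative 2 * c * norm z / (1 - (t * norm z)\<^sup>2)) (at t)"
      unfolding L_def has_real_derivative_iff_has_vector_derivative[symmetric] using tn
      by (auto intro!: derivative_eq_intros) (simp add: field_simps)
    have "1 - (t * norm z)\<^sup>2 > 0" using tn by (simp add: power_less_one_iff)
    then have "norm (deriv g (of_real t * z)) \<le> 2 * c / (1 - (t * norm z)\<^sup>2)"
      using bd[OF tz[of t]] t by (simp add: norm_mult field_simps)
    then show "norm (z * deriv g (of_real t * z)) \<le> 2 * c * norm z / (1 - (t * norm z)\<^sup>2)"
      by (simp add: norm_mult) (metis mult.commute mult_left_mono norm_ge_zero times_divide_eq_right)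
  next
    have tz: "norm (of_real t * z) < 1" if "0 \<le> t" "t \<le> 1" for t :: real
      using that z by (simp add: norm_mult) (smt (verit) mult_left_le_one_le norm_ge_zero)
    show "continuous_on {0..1} (\<lambda>t. g (of_real t * z))"
      using tz by (intro continuous_on_compose2[OF holomorphic_on_imp_continuous_on[OF hol]] continuous_intros) auto
    have "1 + t * norm z \<noteq> 0 \<and> 1 - t * norm z \<noteq> 0" if "t \<in> {0..1}" for t
      using tz[of t] that by (auto simp: norm_mult) (smt (verit) mult_nonneg_nonneg norm_ge_zero)
    then show "continuous_on {0..1} (\<lambda>t. L (t * norm z))"
      unfolding L_def by (intro continuous_intros) auto
  qed auto
  moreover have "L (norm z) - L 0 = c * ln ((1 + norm z) / (1 - norm z))"
    using z ln_divide_pos[of "1 + norm z" "1 - norm z"] norm_ge_zero[of z] by (simp add: L_def add_pos_nonneg)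
  ultimately show ?thesis using \<open>g 0 = 0\<close> by simp
qed

text \<open>For c = 17/50 and r = |z| this is Becker's expression with the bounds for g' and g
  inserted; 17/25 is 2 * c. The factor 1 - r^2 cancels the denominator of (1 + r) / (1 - r), so a
  linear majorant of the power leaves a quadratic inequality in r.\<close>

lemma becker_bound_17_50:
  fixes r :: real
  assumes "0 \<le> r" "r < 1"
  shows "(17/25) * r + (1 - r\<^sup>2) * (((1 + r) / (1 - r)) powr (17/50) - 1) < 1"
proof -
  define X where "X = (1 + r) / (1 - r)"
  have X: "X > 0" using assms by (simp add: X_def)
  have q12: "(12::real) powr (17/50) \<le> 234/100"
  proof -
    \<comment> \<open>Comparing 50th powers reduces the rounding of the irrational power to rational
      arithmetic.\<close>
    have "((12::real) powr (17/50)) ^ 50 = 12 ^ 17"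
      by (simp add: powr_powr flip: powr_realpow)
    also have "\<dots> \<le> (234/100) ^ 50" by (simp add: power_divide)
    finally show ?thesis by (rule power_le_imp_le_base[of _ 49, simplified]) simp
  qed
  \<comment> \<open>tangent line of the concave power at 12, close to the worst case r = 0.85\<close>
  have "X powr (17/50) \<le> (234/100) * (33/50 + (17/600) * X)"
  proof -
    have "(X/12) powr (17/50) * 1 powr (33/50) \<le> (17/50) * (X/12) + (33/50) * 1"
      using X by (intro Youngs_inequality_0) auto
    then have *: "(X/12) powr (17/50) \<le> 33/50 + (17/600) * X" by simp
    have "X powr (17/50) = 12 powr (17/50) * (X/12) powr (17/50)"
      using X by (simp flip: powr_mult)
    also have "\<dots> \<le> (234/100) * (33/50 + (17/600) * X)"
      using X by (intro mult_mono q12 *) auto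
    finally show ?thesis .
  qed
  then have "(1 - r\<^sup>2) * X powr (17/50) \<le> (1 - r\<^sup>2) * ((234/100) * (33/50 + (17/600) * X))"
    using assms by (intro mult_left_mono) (auto simp: power_le_one)
  also have "\<dots> = (234/100) * ((33/50) * (1 - r\<^sup>2) + (17/600) * (1 + r)\<^sup>2)"
    using assms by (simp add: X_def field_simps power2_eq_square)
  also have "\<dots> < 2 - r\<^sup>2 - (17/25) * r"
  proof -
    \<comment> \<open>17/20 nearly minimises the difference of the two quadratics, so this single
      square certifies the inequality.\<close>
    have "0 \<le> r\<^sup>2 - (17/10) * r + 289/400"
      using zero_le_power2[of "r - 17/20"] by (simp add: power2_eq_square algebra_simps)
    moreover have "(1 + r)\<^sup>2 = 1 + 2 * r + r\<^sup>2" by (simp add: power2_eq_square algebra_simps)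
    ultimately show ?thesis using assms by (simp add: field_simps)
  qed
  finally show ?thesis by (simp add: X_def algebra_simps)
qed

text \<open>On the segment from 0 to w the derivative is at most |w| * exp (t * |w|), which
  integrates to the right-hand side.\<close>

lemma norm_exp_minus_1_le: "norm (exp w - 1) \<le> exp (norm w) - 1" for w :: complex
proof -
  have "norm (exp (of_real 1 * w) - exp (of_real 0 * w)) \<le> exp (1 * norm w) - exp (0 * norm w)"
  proof (rule differentiable_bound_general[where f' = "\<lambda>t. w * exp (of_real t * w)"
        and \<phi>' = "\<lambda>t. norm w * exp (t * norm w)"])
    fix t :: real assume "0 < t"
    have "((\<lambda>x. exp (x * w)) has_field_derivative w * exp (of_real t * w)) (at (of_real t))"
      by (auto intro!: derivative_eq_intros)
    from has_vector_derivative_real_field[OF this]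
    show "((\<lambda>t. exp (of_real t * w)) has_vector_derivative w * exp (of_real t * w)) (at t)"
      by (simp add: o_def)
    show "((\<lambda>t. exp (t * norm w)) has_vector_derivative norm w * exp (t * norm w)) (at t)"
      unfolding has_real_derivative_iff_has_vector_derivative[symmetric]
      by (auto intro!: derivative_eq_intros)
    show "norm (w * exp (of_real t * w)) \<le> norm w * exp (t * norm w)"
      using norm_exp[of "of_real t * w"] \<open>0 < t\<close> by (simp add: norm_mult mult_left_mono)
  qed (auto intro!: continuous_intros)
  then show ?thesis by simp
qed

lemma univ_prop_17_50_pi: "univ_prop (17 * pi / 50)"
  unfolding univ_prop_def
proof (intro allI impI, elim conjE)
  define c :: real where "c = 17/50"
  fix f assume "classA f" and
    bnd: "\<forall>z\<in>ball 0 1. (z \<noteq> 0 \<longrightarrow> f z \<noteq> 0) \<and> exp (- (17 * pi / 50) / 2) < cmod (zlogderiv f z) \<and>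
          cmod (zlogderiv f z) < exp (17 * pi / 50 / 2)"
  then have holf: "f holomorphic_on ball 0 1" and f0: "f 0 = 0" "deriv f 0 = 1"
    by (auto simp: classA_def analytic_on_open)
  have fnz: "f z \<noteq> 0" if "norm z < 1" "z \<noteq> 0" for z using bnd that by auto
  \<comment> \<open>Splitting off the zero at the origin makes p = f' / F holomorphic and zero-free
    on the whole disc, so it has a logarithm there.\<close>
  obtain F where F: "F holomorphic_on ball 0 1" "\<And>z. norm z < 1 \<Longrightarrow> f z = z * F z" "deriv f 0 = F 0"
    using Schwarz3[OF holf f0(1)] by blast
  have Fnz: "F z \<noteq> 0" if "norm z < 1" for z
    using F(2)[OF that] fnz[OF that] F(3) f0(2) by (cases "z = 0") auto
  define p where "p z = deriv f z / F z" for z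
  have holp: "p holomorphic_on ball 0 1"
    unfolding p_def using holf F(1) Fnz by (auto intro!: holomorphic_intros holomorphic_deriv)
  have p_eq: "p z = zlogderiv f z" if "norm z < 1" for z
    using F(2)[OF that] F(3) f0 by (simp add: p_def zlogderiv_def)
  have pnz: "p z \<noteq> 0" if "z \<in> ball 0 1" for z
    using bnd that p_eq[of z] by (metis exp_gt_zero mem_ball_0 norm_zero order_less_asym)
  obtain g0 where g0: "g0 holomorphic_on ball 0 1" "\<And>z. z \<in> ball 0 1 \<Longrightarrow> p z = exp (g0 z)"
    using contractible_imp_holomorphic_log[OF holp convex_imp_contractible[OF convex_ball] pnz] by blast
  \<comment> \<open>\<open>g0 0\<close> is only some logarithm of 1; subtracting it keeps the
    exponential and gives g 0 = 0, the starting value for the growth bound.\<close>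
  define g where "g z = g0 z - g0 0" for z
  have holg: "g holomorphic_on ball 0 1" unfolding g_def using g0(1) by (intro holomorphic_intros)
  have g_0: "g 0 = 0" by (simp add: g_def)
  have pg: "p z = exp (g z)" if "norm z < 1" for z
    using g0(2)[of z] g0(2)[of 0] that p_eq[of 0] by (simp add: g_def exp_diff zlogderiv_def)
  have strip: "\<bar>Re (g z)\<bar> < c * pi / 2" if "norm z < 1" for z
  proof -
    have "exp (- (17 * pi / 50) / 2) < exp (Re (g z))" "exp (Re (g z)) < exp (17 * pi / 50 / 2)"
      using bnd that p_eq[OF that] pg[OF that] by (auto simp flip: norm_exp_eq_Re)
    then show ?thesis by (simp add: c_def abs_less_iff)
  qed
  have g': "(1 - (norm z)\<^sup>2) * norm (deriv g z) \<le> 2 * c" if "norm z < 1" for z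
    by (rule Schwarz_Pick_strip[OF holg _ strip that]) (auto simp: c_def)
  have g: "norm (g z) \<le> c * ln ((1 + norm z) / (1 - norm z))" if "norm z < 1" for z
    by (rule norm_le_if_Bloch_bound[OF holg g_0 g' that])
  have f'nz: "deriv f z \<noteq> 0" if "norm z < 1" for z
    using pnz[of z] that by (auto simp: p_def)
  \<comment> \<open>Obtained by differentiating z f' = f exp g, which avoids a logarithmic
    derivative of f at its zero.\<close>
  have f'': "z * deriv (deriv f) z = deriv f z * (z * deriv g z + (exp (g z) - 1))" if z: "norm z < 1" for z
  proof -
    have zf': "z * deriv f z = f z * exp (g z)" if "z \<in> ball 0 1" for z
      using pg[of z] F(2)[of z] Fnz[of z] that by (auto simp: p_def field_simps)
    have [derivative_intros]: "(f has_field_derivative deriv f z) (at z)"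
       "(deriv f has_field_derivative deriv (deriv f) z) (at z)"
       "(g has_field_derivative deriv g z) (at z)"
      using holf holg z by (auto intro!: holomorphic_derivI holomorphic_deriv)
    have "((\<lambda>z. z * deriv f z) has_field_derivative deriv f z + z * deriv (deriv f) z) (at z)"
      by (auto intro!: derivative_eq_intros)
    moreover have "((\<lambda>z. f z * exp (g z)) has_field_derivative
        deriv f z * exp (g z) + f z * exp (g z) * deriv g z) (at z)"
      by (auto intro!: derivative_eq_intros)
    then have "((\<lambda>z. z * deriv f z) has_field_derivative
        deriv f z * exp (g z) + f z * exp (g z) * deriv g z) (at z)"
      by (rule has_field_derivative_transform_within_open[of _ _ _ "ball 0 1"]) (use zf' z in auto)
    ultimately have "deriv f z + z * deriv (deriv f) z = deriv f z * exp (g z) + f z * exp (g z) * deriv g z"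
      by (rule DERIV_unique)
    then show ?thesis using zf'[of z] z by (simp add: algebra_simps)
  qed
  show "inj_on f (ball 0 1)"
  proof (rule becker_univalence_criterion[OF holf f'nz])
    fix z :: complex assume z: "norm z < 1"
    define r where "r = norm z"
    have r: "0 \<le> r" "r < 1" using z by (auto simp: r_def)
    define X where "X = (1 + r) / (1 - r)"
    have X: "X > 0" using r by (simp add: X_def)
    have "norm (exp (g z) - 1) \<le> exp (norm (g z)) - 1"
      by (rule norm_exp_minus_1_le)
    also have "\<dots> \<le> X powr c - 1"
      using g[OF z] X by (simp add: powr_def flip: X_def r_def)
    finally have e: "norm (exp (g z) - 1) \<le> X powr c - 1" .
    have r2: "1 - r\<^sup>2 \<ge> 0" using r by (simp add: power_le_one)
    have "(1 - r\<^sup>2) * norm (z * deriv g z + (exp (g z) - 1))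
       \<le> (1 - r\<^sup>2) * (r * norm (deriv g z) + (X powr c - 1))"
      using e by (intro mult_left_mono[OF _ r2] order.trans[OF norm_triangle_ineq] add_mono)
        (auto simp: norm_mult r_def)
    also have "\<dots> = r * ((1 - r\<^sup>2) * norm (deriv g z)) + (1 - r\<^sup>2) * (X powr c - 1)"
      by (simp add: algebra_simps)
    also have "\<dots> \<le> r * (2 * c) + (1 - r\<^sup>2) * (X powr c - 1)"
      using g'[OF z] r by (intro add_right_mono mult_left_mono) (auto simp: r_def)
    also have "\<dots> < 1" using becker_bound_17_50[OF r] by (simp add: c_def X_def mult.commute)
    finally have "norm (deriv f z) * ((1 - r\<^sup>2) * norm (z * deriv g z + (exp (g z) - 1))) < norm (deriv f z) * 1"
      using f'nz[OF z] by (intro mult_strict_left_mono) auto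
    then show "(1 - (norm z)\<^sup>2) * norm (z * deriv (deriv f) z) < norm (deriv f z)"
      unfolding f''[OF z] by (simp add: norm_mult r_def mult_ac)
  qed auto
qed

subsection \<open>The upper bound\<close>

text \<open>On the upper and lower unit semicircles, parametrised by u = ln (cot (phi / 2)), the argument of
  the extremal function f is \<open>Y\<^sub>1\<close> and \<open>Y\<^sub>2\<close>. A fixed combination of them is constant, with value known
  from the symmetry at u = 0, and their difference tends to 0 at the corner z = 1. So only the tail
  integral of that difference has to be estimated.\<close>
lemma boundary_argument_exceeds:
  fixes Y\<^sub>1 Y\<^sub>2 :: "real \<Rightarrow> real" and c x U :: real
  assumes Y1: "\<And>u. u \<ge> 0 \<Longrightarrow> (Y\<^sub>1 has_real_derivative - (exp (- x) * cos (c * u) / cosh u)) (at u)"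
    and Y2: "\<And>u. u \<ge> 0 \<Longrightarrow> (Y\<^sub>2 has_real_derivative exp x * cos (c * u) / cosh u) (at u)"
    and init: "Y\<^sub>1 0 = pi / 2" "Y\<^sub>2 0 = - pi / 2"
    and gap: "\<And>u. u > 0 \<Longrightarrow> \<bar>Y\<^sub>1 u - Y\<^sub>2 u\<bar> \<le> pi * exp x / sinh u"
    and c: "0 \<le> c" "c \<le> 1" and U: "U \<ge> 0" "cos (c * U) = 0" "sin (c * U) = 1"
    and num: "pi * exp (- 2 * x) < 4 * cosh x * (c * exp (- U) / (1 + c\<^sup>2) - exp (- 3 * U) / 3)"
  shows "Y\<^sub>2 U > pi / 2"
proof -
  define D where "D u = Y\<^sub>1 u - Y\<^sub>2 u" for u
  \<comment> \<open>B is the tail integral of D' with 1 / cosh u replaced by 2 exp (- u)\<close>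
  define B where "B u = 4 * cosh x * exp (- u) * (cos (c * u) - c * sin (c * u)) / (1 + c\<^sup>2)" for u
  \<comment> \<open>The difference 2 * exp (- u) - 1 / cosh u lies between 0 and 2 * exp (- 3 * u).
    Times 2 * cosh x this error is at most 4 * cosh x * exp (- 3 * u); subtracting the last term
    adds that much to the derivative and makes \<open>Q\<close> nondecreasing.\<close>
  define Q where "Q u = D u - B u - 4/3 * cosh x * exp (- 3 * u)" for u
  have c2: "1 + c\<^sup>2 > 0" by (simp add: add_pos_nonneg)
  have dD: "(D has_real_derivative - (2 * cosh x * cos (c * u) / cosh u)) (at u)" if "u \<ge> 0" for u
  proof -
    have ch: "2 * cosh x = exp x + exp (- x)" by (simp add: cosh_field_def)
    show ?thesis unfolding D_def[abs_def] ch
      by (rule DERIV_cong[OF DERIV_diff[OF Y1[OF that] Y2[OF that]]]) (simp add: field_simps)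
  qed
  have dB: "(B has_real_derivative - (4 * cosh x * exp (- u) * cos (c * u))) (at u)" for u
  proof -
    have "((\<lambda>u. exp (- u) * (cos (c * u) - c * sin (c * u))) has_real_derivative
        - ((1 + c\<^sup>2) * (exp (- u) * cos (c * u)))) (at u)"
      by (auto intro!: derivative_eq_intros simp: algebra_simps power2_eq_square)
    from DERIV_cmult[OF this, of "4 * cosh x / (1 + c\<^sup>2)"] show ?thesis
      unfolding B_def[abs_def] using c2 by (simp add: mult.assoc)
  qed
  have Qmono: "Q U \<le> Q v" if "U \<le> v" for v
  proof (rule DERIV_nonneg_imp_nondecreasing[OF that])
    fix u assume "U \<le> u"
    then have u: "u \<ge> 0" using U by simp
    let ?d = "- (2 * cosh x * cos (c * u) / cosh u) + 4 * cosh x * exp (- u) * cos (c * u) + 4 * cosh x * exp (- 3 * u)"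
    have "(Q has_real_derivative ?d) (at u)"
      unfolding Q_def[abs_def] by (auto intro!: derivative_eq_intros dD dB u)
    moreover have "?d \<ge> 0"
    proof -
      define t where "t = exp (- u)"
      have t: "t > 0" by (simp add: t_def)
      have ch: "cosh u = (1 + t\<^sup>2) / (2 * t)"
        by (simp add: cosh_field_def t_def exp_minus field_simps power2_eq_square)
      have e3: "exp (- 3 * u) = t ^ 3"
        by (simp add: t_def flip: exp_of_nat_mult)
      have "1 + t\<^sup>2 > 0" by (simp add: add_pos_nonneg)
      then have "?d = 4 * cosh x * t ^ 3 * (1 + cos (c * u) / (1 + t\<^sup>2))"
        unfolding ch e3 t_def[symmetric] using t
        by (simp add: field_simps power2_eq_square power3_eq_cube)
      moreover have "1 + cos (c * u) / (1 + t\<^sup>2) \<ge> 0"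
      proof -
        have "- 1 * (1 + t\<^sup>2) \<le> cos (c * u)"
          using cos_ge_minus_one[of "c * u"] zero_le_power2[of t] by (smt (verit))
        then have "- 1 \<le> cos (c * u) / (1 + t\<^sup>2)"
          using \<open>1 + t\<^sup>2 > 0\<close> by (simp only: pos_le_divide_eq)
        then show ?thesis by simp
      qed
      ultimately show ?thesis using t by simp
    qed
    ultimately show "\<exists>y. DERIV Q u :> y \<and> y \<ge> 0" by blast
  qed
  \<comment> \<open>The gap hypothesis makes \<open>D\<close> vanish at infinity. Since
    \<open>Q\<close> is nondecreasing from \<open>U\<close> on, a vanishing upper bound forces
    \<open>Q U\<close> \<le> 0.\<close>
  have Qle: "Q v \<le> (4 * pi * exp x + 8 * cosh x) * exp (- v)" if "v \<ge> 1" for v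
  proof -
    have "exp (- v) \<le> exp v / 2"
    proof -
      have "2 \<le> exp v * exp v"
        using exp_ge_add_one_self[of "v + v"] that unfolding exp_add by linarith
      then have "exp (- v) * 2 \<le> exp (- v) * (exp v * exp v)" by (intro mult_left_mono) auto
      also have "\<dots> = exp v" by (simp add: exp_minus)
      finally show ?thesis by simp
    qed
    then have s: "exp v / 4 \<le> sinh v" by (simp add: sinh_field_def)
    have "D v \<le> pi * exp x / sinh v" using gap[of v] that by (simp add: D_def)
    also have "\<dots> \<le> pi * exp x / (exp v / 4)"
      using s that by (intro divide_left_mono) auto
    also have "\<dots> = 4 * pi * exp x * exp (- v)" by (simp add: exp_minus field_simps)
    finally have "D v \<le> 4 * pi * exp x * exp (- v)" .
    moreover have "- B v \<le> 8 * cosh x * exp (- v)"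
    proof -
      define y where "y = cos (c * v) - c * sin (c * v)"
      have "\<bar>c * sin (c * v)\<bar> \<le> 1"
        using c abs_sin_le_one[of "c * v"] by (simp add: abs_mult mult_le_one)
      then have "- y \<le> 2 * 1"
        using abs_cos_le_one[of "c * v"] unfolding y_def by linarith
      also have "\<dots> \<le> 2 * (1 + c\<^sup>2)" by simp
      finally have "- y / (1 + c\<^sup>2) \<le> 2"
        using c2 by (simp only: pos_divide_le_eq)
      then have "4 * cosh x * exp (- v) * (- y / (1 + c\<^sup>2)) \<le> 4 * cosh x * exp (- v) * 2"
        by (intro mult_left_mono) auto
      then show ?thesis by (simp add: B_def flip: y_def)
    qed
    moreover have "0 \<le> 4/3 * cosh x * exp (- 3 * v)" by simp
    ultimately show ?thesis unfolding Q_def distrib_right by linarith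
  qed
  have "Q U \<le> 0"
  proof (rule tendsto_lowerbound)
    have "((\<lambda>v::real. exp (- v)) \<longlongrightarrow> 0) at_top"
      by (rule filterlim_compose[OF exp_at_bot filterlim_uminus_at_bot_at_top])
    then show "((\<lambda>v. (4 * pi * exp x + 8 * cosh x) * exp (- v)) \<longlongrightarrow> 0) at_top"
      by (rule tendsto_mult_right_zero)
    show "\<forall>\<^sub>F v in at_top. Q U \<le> (4 * pi * exp x + 8 * cosh x) * exp (- v)"
      using eventually_ge_at_top[of "max 1 U"]
      by eventually_elim (use Qmono Qle in \<open>fastforce intro: order.trans\<close>)
  qed simp
  have "D U \<le> - 4 * cosh x * (c * exp (- U) / (1 + c\<^sup>2) - exp (- 3 * U) / 3)"
  proof -
    have "B U = - (4 * cosh x * (c * exp (- U) / (1 + c\<^sup>2)))" by (simp add: B_def U)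
    with \<open>Q U \<le> 0\<close> show ?thesis by (simp add: Q_def right_diff_distrib)
  qed
  with num have "pi * exp (- 2 * x) < - D U" by linarith
  then have "exp x * (pi * exp (- 2 * x)) < exp x * (- D U)" by (intro mult_strict_left_mono) auto
  moreover have "exp x * (pi * exp (- 2 * x)) = pi * exp (- x)"
    by (simp add: mult.left_commute flip: exp_add)
  ultimately have D: "pi * exp (- x) < - (exp x * D U)" by (metis mult_minus_right)
  have const: "\<exists>k. \<forall>u\<in>{0..}. exp x * Y\<^sub>1 u + exp (- x) * Y\<^sub>2 u = k"
  proof (rule has_field_derivative_zero_constant)
    fix u :: real assume "u \<in> {0..}"
    then have "((\<lambda>u. exp x * Y\<^sub>1 u + exp (- x) * Y\<^sub>2 u) has_real_derivative
      exp x * - (exp (- x) * cos (c * u) / cosh u) + exp (- x) * (exp x * cos (c * u) / cosh u)) (at u)"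
      by (intro DERIV_add DERIV_cmult Y1 Y2) auto
    moreover have "exp x * - (exp (- x) * cos (c * u) / cosh u) + exp (- x) * (exp x * cos (c * u) / cosh u) = 0"
      by (simp add: mult_ac)
    ultimately show "((\<lambda>u. exp x * Y\<^sub>1 u + exp (- x) * Y\<^sub>2 u) has_real_derivative 0) (at u within {0..})"
      by (metis has_field_derivative_at_within)
  qed simp
  \<comment> \<open>The weights cancel the two derivatives, and at u = 0 the sum is (exp x - exp (-
    x)) * pi / 2. Hence \<open>Y\<^sub>2 U\<close> exceeds pi / 2 exactly when - exp x * D U exceeds
    pi * exp (- x).\<close>
  have "exp x * Y\<^sub>1 U + exp (- x) * Y\<^sub>2 U = exp x * Y\<^sub>1 0 + exp (- x) * Y\<^sub>2 0"
    using const U(1) by auto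
  then have "(exp x + exp (- x)) * Y\<^sub>2 U + exp x * D U = (exp x - exp (- x)) * (pi / 2)"
    by (simp add: D_def init algebra_simps)
  with D have "(exp x + exp (- x)) * Y\<^sub>2 U > (exp x + exp (- x)) * (pi / 2)"
    by (simp add: algebra_simps)
  then show ?thesis by (simp add: add_pos_pos)
qed

section \<open>The primitive in the strip coordinate and its reflection symmetry\<close>

lemma holomorphic_on_quotient_by_id:
  assumes "g holomorphic_on S" "open S" "g 0 = (0::complex)"
  shows "(\<lambda>z. if z = 0 then deriv g 0 else g z / z) holomorphic_on S"
  by (rule pole_theorem_open_0[OF assms(1,2), of 0]) (auto simp: assms(3))

lemma sinh_eq_0_iff_strip:
  assumes "\<bar>Im w\<bar> < pi" shows "sinh w = 0 \<longleftrightarrow> w = (0::complex)"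
proof
  assume "sinh w = 0"
  then have "exp w = exp (- w)" by (simp add: sinh_field_def)
  then have "w = - w" using assms by (intro exp_complex_eqI[of w "- w"]) auto
  then show "w = 0" by simp
qed simp

lemma open_strip: "open {w. \<bar>Im w\<bar> < b}"
  by (intro open_Collect_less continuous_intros)

lemma convex_strip: "convex {w. \<bar>Im w\<bar> < b}"
proof -
  have "{w. \<bar>Im w\<bar> < b} = {w. Im w < b} \<inter> {w. Im w > - b}" by auto
  then show ?thesis by (simp add: convex_Int convex_halfspace_Im_lt convex_halfspace_Im_gt)
qed

text \<open>With w = ln ((1 + z) / (1 - z)) one has dz / z = dw / sinh w, so H is the primitive of (p - 1) / z for
  p = ((1 + z) / (1 - z)) powr (i c). In this coordinate it extends across the unit circle,
  which is the pair of lines Im w = \<open>\<plusminus>\<close> pi / 2.\<close>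
lemma strip_primitive:
  fixes c :: real
  defines "K \<equiv> \<lambda>w. if w = 0 then \<i> * c else (exp (\<i> * c * w) - 1) / sinh w"
  obtains H where "\<And>w. \<bar>Im w\<bar> < pi \<Longrightarrow> (H has_field_derivative K w) (at w)"
    "H 0 = 0" "\<And>w. \<bar>Im w\<bar> < pi \<Longrightarrow> H (- cnj w) = cnj (H w)"
proof -
  define W where "W = {w. \<bar>Im w\<bar> < pi}"
  have W: "open W" "convex W" "0 \<in> W" by (auto simp: W_def open_strip convex_strip)
  define a where "a w = exp (\<i> * c * w) - 1" for w
  \<comment> \<open>Numerator and denominator of \<open>K\<close> are each divided by w. Both
    quotients are holomorphic, \<open>B\<close> has no zero in the strip, and A / B takes the value
    i c at 0.\<close>
  define A where "A w = (if w = 0 then deriv a 0 else a w / w)" for w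
  define B where "B w = (if w = 0 then deriv sinh 0 else sinh w / w)" for w :: complex
  have "(a has_field_derivative \<i> * c) (at 0)"
    unfolding a_def[abs_def] by (auto intro!: derivative_eq_intros)
  then have a': "deriv a 0 = \<i> * c" by (rule DERIV_imp_deriv)
  have "(sinh has_field_derivative (1::complex)) (at 0)"
    by (auto intro!: derivative_eq_intros)
  then have s': "deriv sinh (0::complex) = 1" by (rule DERIV_imp_deriv)
  have holA: "A holomorphic_on W"
    unfolding A_def[abs_def] by (rule holomorphic_on_quotient_by_id) (auto simp: a_def[abs_def] W intro!: holomorphic_intros)
  have holB: "B holomorphic_on W"
    unfolding B_def[abs_def] by (rule holomorphic_on_quotient_by_id) (auto simp: W sinh_field_def[abs_def] intro!: holomorphic_intros)
  have "B w \<noteq> 0" if "w \<in> W" for w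
    using that sinh_eq_0_iff_strip[of w] by (auto simp: B_def s' W_def)
  then have "(\<lambda>w. A w / B w) holomorphic_on W" using holA holB by (intro holomorphic_intros) auto
  then have "K holomorphic_on W"
    by (rule holomorphic_transform) (auto simp: K_def A_def B_def a' s' a_def)
  then obtain H0 where H0: "\<And>w. w \<in> W \<Longrightarrow> (H0 has_field_derivative K w) (at w within W)"
    using holomorphic_convex_primitive'[OF W(2,1)] by blast
  define H where "H w = H0 w - H0 0" for w
  have dH: "(H has_field_derivative K w) (at w)" if "w \<in> W" for w
    using H0[OF that] at_within_open[OF that W(1)] unfolding H_def[abs_def]
    by (auto intro!: derivative_eq_intros)
  \<comment> \<open>The reflection of \<open>H\<close> in the imaginary axis. It has the same
    derivative \<open>K\<close> and the same value at 0, so it coincides with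
    \<open>H\<close>.\<close>
  define N where "N = cnj \<circ> (\<lambda>w. H (- w)) \<circ> cnj"
  have dN: "(N has_field_derivative K w) (at w)" if "w \<in> W" for w
  proof -
    have "(H has_field_derivative K (- cnj w)) (at (- cnj w))"
      using that by (intro dH) (auto simp: W_def)
    then have "((\<lambda>w. H (- w)) has_field_derivative K (- cnj w) * (- 1)) (at (cnj w))"
      by (rule DERIV_chain2) (auto intro!: derivative_eq_intros)
    then have "(N has_field_derivative cnj (K (- cnj w) * (- 1))) (at w)"
      unfolding N_def by (rule has_field_derivative_cnj_cnj)
    also have "cnj (K (- cnj w) * (- 1)) = K w"
      by (simp add: K_def sinh_field_def exp_cnj minus_divide_right)
    finally show ?thesis .
  qed
  have const: "\<exists>k. \<forall>w\<in>W. N w - H w = k"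
  proof (rule has_field_derivative_zero_constant[OF W(2)])
    fix w assume "w \<in> W"
    from DERIV_diff[OF dN[OF this] dH[OF this]]
    show "((\<lambda>w. N w - H w) has_field_derivative 0) (at w within W)"
      by (simp add: has_field_derivative_at_within)
  qed
  have NH: "N w = H w" if "w \<in> W" for w
  proof -
    have "N w - H w = N 0 - H 0" using that W(3) const by metis
    then show ?thesis by (simp add: N_def H_def)
  qed
  show ?thesis
  proof (rule that)
    show "H (- cnj w) = cnj (H w)" if "\<bar>Im w\<bar> < pi" for w
      using NH[of w] that by (simp add: N_def W_def) (metis complex_cnj_cnj)
    show "H 0 = 0" by (simp add: H_def)
  qed (use dH in \<open>auto simp: W_def\<close>)
qed


text \<open>With a = exp (- U) and b = exp x the claim becomes pi < 2 * (b^3 + b) * (c * a / (1 +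
  c^2) - a^3 / 3). Only a lower bound on b is needed, but bounds on both sides of a. The decimals
  chosen leave a margin of less than one percent.\<close>

lemma boundary_numeric_bound:
  fixes c x U :: real
  defines "c \<equiv> 57/80" and "x \<equiv> 57/80 * pi / 2" and "U \<equiv> pi / (2 * (57/80))"
  shows "pi * exp (- 2 * x) < 4 * cosh x * (c * exp (- U) / (1 + c\<^sup>2) - exp (- 3 * U) / 3)"
proof -
  have e: "exp 1 > (2.718::real)" "exp 1 < (2.72::real)"
    using e_approx_32 e_less_272 by (simp_all add: abs_if split: if_splits)
  have x: "x \<ge> 1.119" and U: "U \<ge> 2.2" "U \<le> 2.205" and pi: "pi < 3.1416"
    using pi_approx by (auto simp: x_def U_def field_simps)
  have ex: "exp x \<ge> 3.05"
  proof -
    have "(3.05::real) \<le> 2.718 * 1.0595 ^ 2" by (simp add: power2_eq_square)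
    also have "\<dots> \<le> exp 1 * exp 0.0595 ^ 2"
      using e exp_ge_add_one_self[of "0.0595::real"] by (intro mult_mono power_mono) auto
    also have "\<dots> = exp (1.119::real)" by (simp flip: exp_add exp_of_nat_mult)
    also have "\<dots> \<le> exp x" using x by simp
    finally show ?thesis .
  qed
  have eU: "exp U \<le> 1 / 0.108"
  proof -
    have "exp U \<le> exp (2.205::real)" using U by simp
    also have "\<dots> = exp 1 ^ 2 * exp (0.205::real)" by (simp flip: exp_add exp_of_nat_mult)
    also have "\<dots> \<le> 2.72 ^ 2 * (1 + 0.205 + 0.205\<^sup>2)"
      using e exp_bound[of "0.205::real"] by (intro mult_mono power_mono) auto
    also have "\<dots> \<le> 1 / 0.108" by (simp add: power2_eq_square)
    finally show ?thesis .
  qed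
  have eU': "exp U \<ge> 1 / 0.12"
  proof -
    have "1 / 0.12 \<le> (2.718::real) ^ 2 * 1.2" by (simp add: power2_eq_square)
    also have "\<dots> \<le> exp 1 ^ 2 * exp 0.2"
      using e exp_ge_add_one_self[of "0.2::real"] by (intro mult_mono power_mono) auto
    also have "\<dots> = exp (2.2::real)" by (simp flip: exp_add exp_of_nat_mult)
    also have "\<dots> \<le> exp U" using U by simp
    finally show ?thesis .
  qed
  define a where "a = exp (- U)"
  have a: "a \<ge> 0.108" "a \<le> 0.12"
    using eU eU' by (auto simp: a_def exp_minus field_simps)
  have a3: "exp (- 3 * U) = a ^ 3" by (simp add: a_def flip: exp_of_nat_mult)
  have "a ^ 3 \<le> 0.12 ^ 3" using a by (intro power_mono) auto
  then have inner: "c * a / (1 + c\<^sup>2) - a ^ 3 / 3 \<ge> 0.0504"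
    using a by (simp add: c_def power_divide power3_eq_cube)
  define b where "b = exp x"
  have b: "b \<ge> 3.05" using ex by (simp add: b_def)
  have "pi < 2 * (3.05 ^ 3 + 3.05) * 0.0504" using pi by (simp add: power3_eq_cube)
  also have "\<dots> \<le> 2 * (b ^ 3 + b) * (c * a / (1 + c\<^sup>2) - a ^ 3 / 3)"
    using b inner by (intro mult_mono add_mono power_mono) auto
  finally have "pi / b\<^sup>2 < 2 * (b ^ 3 + b) * (c * a / (1 + c\<^sup>2) - a ^ 3 / 3) / b\<^sup>2"
    using b by (intro divide_strict_right_mono) auto
  also have "\<dots> = 2 * (b + 1 / b) * (c * a / (1 + c\<^sup>2) - a ^ 3 / 3)"
  proof -
    have "(b ^ 3 + b) / b\<^sup>2 = b + 1 / b"
      using b by (simp add: field_simps power2_eq_square power3_eq_cube)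
    then show ?thesis by (metis times_divide_eq_left times_divide_eq_right)
  qed
  also have "2 * (b + 1 / b) = 4 * cosh x"
  proof -
    have "1 / b = exp (- x)" unfolding b_def exp_minus inverse_eq_divide by (rule refl)
    then show ?thesis by (simp add: cosh_field_def b_def)
  qed
  also have "pi / b\<^sup>2 = pi * exp (- 2 * x)"
  proof -
    have "b\<^sup>2 = exp (2 * x)" by (simp add: b_def exp_double)
    moreover have "exp (- 2 * x) = inverse (exp (2 * x))" using exp_minus[of "2 * x"] by simp
    ultimately show ?thesis by (simp only: divide_inverse)
  qed
  finally show ?thesis by (simp only: a3 flip: a_def)
qed

text \<open>The logarithmic derivative of f z / z must be (p - 1) / z, whose primitive is H (L z);
  hence f = z * exp (H (L z)). On the disc |p| = exp (- c * Im (L z)) with |Im (L z)| < pi / 2, so f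
  is admissible.\<close>

lemma not_univ_prop_57_80_pi: "\<not> univ_prop (57 * pi / 80)"
proof
  assume univ: "univ_prop (57 * pi / 80)"
  define c :: real where "c = 57/80"
  define x where "x = c * pi / 2"
  define U where "U = pi / (2 * c)"
  define K where "K = (\<lambda>w. if w = 0 then \<i> * c else (exp (\<i> * c * w) - 1) / sinh w)"
  obtain H where dH: "\<And>w. \<bar>Im w\<bar> < pi \<Longrightarrow> (H has_field_derivative K w) (at w)"
    and H0: "H 0 = 0" and Hsym: "\<And>w. \<bar>Im w\<bar> < pi \<Longrightarrow> H (- cnj w) = cnj (H w)"
    unfolding K_def using strip_primitive[of c] by blast
  define L where "L z = Ln ((1 + z) / (1 - z))" for z
  define f where "f z = z * exp (H (L z))" for z

  have Re_pos: "Re ((1 + z) / (1 - z)) > 0" if "norm z < 1" for z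
  proof -
    have "(norm z)\<^sup>2 < 1" using that by (simp add: power_less_one_iff)
    then show ?thesis
      unfolding Re_complex_div_gt_0 cmod_power2 by (simp add: algebra_simps power2_eq_square)
  qed
  have nz: "1 - z \<noteq> 0" "1 + z \<noteq> 0" "1 - z\<^sup>2 \<noteq> 0" if "norm z < 1" for z :: complex
  proof -
    show a: "1 - z \<noteq> 0" "1 + z \<noteq> 0"
      using that Re_pos[OF that] by auto
    have "1 - z\<^sup>2 = (1 - z) * (1 + z)" by (simp add: algebra_simps power2_eq_square)
    then show "1 - z\<^sup>2 \<noteq> 0" using a by simp
  qed
  have ImL: "\<bar>Im (L z)\<bar> < pi / 2" if "norm z < 1" for z
    unfolding L_def using Re_pos[OF that] by (subst Re_Ln_pos_lt) auto
  have expL: "exp (L z) = (1 + z) / (1 - z)" if "norm z < 1" for z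
    using nz[OF that] by (simp add: L_def)
  have dL: "(L has_field_derivative 2 / (1 - z\<^sup>2)) (at z)" if "norm z < 1" for z
  proof -
    have "(1 + z) / (1 - z) \<notin> \<real>\<^sub>\<le>\<^sub>0" using Re_pos[OF that] by (auto simp: complex_nonpos_Reals_iff)
    moreover have "((\<lambda>z. (1 + z) / (1 - z)) has_field_derivative 2 / (1 - z)\<^sup>2) (at z)"
      using nz[OF that] by (auto intro!: derivative_eq_intros simp: power2_eq_square algebra_simps)
    ultimately have "(L has_field_derivative inverse ((1 + z) / (1 - z)) * (2 / (1 - z)\<^sup>2)) (at z)"
      unfolding L_def[abs_def] by (intro DERIV_chain2[OF has_field_derivative_Ln]) auto
    also have "inverse ((1 + z) / (1 - z)) * (2 / (1 - z)\<^sup>2) = 2 / (1 - z\<^sup>2)"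
    proof -
      have eq: "1 - z\<^sup>2 = (1 - z) * (1 + z)" by (simp add: algebra_simps power2_eq_square)
      have gen: "inverse (b / a) * (2 / a\<^sup>2) = 2 / (a * b)" if "a \<noteq> 0" "b \<noteq> 0" for a b :: complex
        using that by (simp add: field_simps power2_eq_square)
      show ?thesis unfolding eq by (rule gen[OF nz(1,2)[OF that]])
    qed
    finally show ?thesis .
  qed
  \<comment> \<open>Here sinh (L z) = 2 * z / (1 - z^2) is z times the derivative of
    \<open>L\<close>, so the factor z and the denominator of \<open>K\<close> cancel.\<close>
  have ode: "1 + z * (K (L z) * (2 / (1 - z\<^sup>2))) = exp (\<i> * c * L z)" if z: "norm z < 1" for z
  proof (cases "z = 0")
    case False
    have "L z \<noteq> 0" using expL[OF z] False nz[OF z] by auto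
    moreover have "sinh (L z) = 2 * z / (1 - z\<^sup>2)"
    proof -
      have "1 - z\<^sup>2 = (1 - z) * (1 + z)" by (simp add: algebra_simps power2_eq_square)
      then show ?thesis using nz[OF z]
        by (simp add: sinh_field_def exp_minus expL[OF z] field_simps)
    qed
    moreover have "1 + z * ((E - 1) / (2 * z / m) * (2 / m)) = E" if "m \<noteq> 0" for E m
      using that False by (simp add: field_simps)
    ultimately show ?thesis using nz(3)[OF z] by (simp add: K_def)
  qed (simp add: L_def)
  have df: "(f has_field_derivative exp (H (L z)) * exp (\<i> * c * L z)) (at z)" if z: "norm z < 1" for z
  proof -
    have "((\<lambda>z. H (L z)) has_field_derivative K (L z) * (2 / (1 - z\<^sup>2))) (at z)"
      using ImL[OF z] pi_gt_zero by (intro DERIV_chain2[OF dH dL[OF z]]) linarith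
    then have "(f has_field_derivative exp (H (L z)) * (1 + z * (K (L z) * (2 / (1 - z\<^sup>2))))) (at z)"
      unfolding f_def[abs_def] by (auto intro!: derivative_eq_intros simp: algebra_simps)
    then show ?thesis unfolding ode[OF z] .
  qed
  have f': "deriv f z = exp (H (L z)) * exp (\<i> * c * L z)" if "norm z < 1" for z
    using df[OF that] by (rule DERIV_imp_deriv)
  have L0: "L 0 = 0" by (simp add: L_def)
  have "f holomorphic_on ball 0 1"
    using df unfolding holomorphic_on_open[OF open_ball] by (metis mem_ball_0)
  then have "classA f"
    using f'[of 0] by (auto simp: classA_def analytic_on_open f_def L0 H0)
  moreover have "(z \<noteq> 0 \<longrightarrow> f z \<noteq> 0) \<and> exp (- (57 * pi / 80) / 2) < norm (zlogderiv f z) \<and>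
          norm (zlogderiv f z) < exp (57 * pi / 80 / 2)" if "z \<in> ball 0 1" for z
  proof -
    have "zlogderiv f z = exp (\<i> * c * L z)"
      using that f'[of z] by (auto simp: zlogderiv_def f_def L0)
    then have "norm (zlogderiv f z) = exp (- (c * Im (L z)))" by simp
    moreover have "\<bar>c * Im (L z)\<bar> < c * (pi / 2)"
      using ImL[of z] that by (simp add: abs_mult c_def)
    ultimately show ?thesis by (auto simp: f_def c_def abs_less_iff)
  qed
  ultimately have inj: "inj_on f (ball 0 1)"
    using univ unfolding univ_prop_def by blast
  \<comment> \<open>The reflection of z in the imaginary axis corresponds under \<open>L\<close> to
    the same reflection of w, for which \<open>H\<close> has its symmetry.\<close>
  have fsym: "f (- cnj z) = - cnj (f z)" if z: "norm z < 1" for z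
  proof -
    define q where "q = (1 + z) / (1 - z)"
    have q: "q \<notin> \<real>\<^sub>\<le>\<^sub>0" "cnj q \<notin> \<real>\<^sub>\<le>\<^sub>0"
      using Re_pos[OF z] by (auto simp: complex_nonpos_Reals_iff q_def[symmetric])
    have "L (- cnj z) = Ln (inverse (cnj q))" by (simp add: L_def q_def)
    also have "\<dots> = - cnj (L z)"
      using Ln_inverse[OF q(2)] cnj_Ln[OF q(1)] by (simp add: L_def q_def[symmetric])
    finally have "H (L (- cnj z)) = cnj (H (L z))"
      using Hsym[of "L z"] ImL[OF z] pi_gt_zero by simp
    then show ?thesis by (simp add: f_def exp_cnj)
  qed

  define T where "T w = (exp w - 1) / (exp w + 1)" for w :: complex
  \<comment> \<open>log f in the coordinate w = L z, with \<open>T\<close> inverse to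
    \<open>L\<close>. For Re w \<ge> 0 and w \<noteq> 0 in the closed strip, T w avoids the cut of
    the principal logarithm, so Im (G w) is a smooth argument of f up to the boundary.\<close>
  define G where "G w = Ln (T w) + H w" for w
  have exp_pos: "Re (exp w) \<ge> 0" if "\<bar>Im w\<bar> \<le> pi / 2" for w
    using that by (auto simp: Re_exp abs_le_iff intro!: mult_nonneg_nonneg cos_ge_zero)
  have e1: "exp w + 1 \<noteq> 0" if "\<bar>Im w\<bar> \<le> pi / 2" for w
    using exp_pos[OF that] by (auto simp: complex_eq_iff)
  have ReT: "Re (T w) > 0 \<longleftrightarrow> Re w > 0" if "\<bar>Im w\<bar> \<le> pi / 2" for w
  proof -
    have "Re (T w) > 0 \<longleftrightarrow> (norm (exp w))\<^sup>2 > 1"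
      unfolding T_def Re_complex_div_gt_0 cmod_power2 by (simp add: algebra_simps power2_eq_square)
    also have "\<dots> \<longleftrightarrow> norm (exp w) > 1"
      using power_mono_iff[of "norm (exp w)" 1 2] by (simp add: linorder_not_le[symmetric])
    also have "\<dots> \<longleftrightarrow> Re w > 0" by simp
    finally show ?thesis .
  qed
  have T_nonpos: "T w \<notin> \<real>\<^sub>\<le>\<^sub>0" if w: "\<bar>Im w\<bar> \<le> pi / 2" "Re w \<ge> 0" "w \<noteq> 0" for w
  proof
    assume T: "T w \<in> \<real>\<^sub>\<le>\<^sub>0"
    then have "Re w = 0" using ReT[OF w(1)] w(2) by (auto simp: complex_nonpos_Reals_iff)
    then have "\<not> Re (T (- w)) > 0" using ReT[of "- w"] w(1) by simp
    moreover have "T (- w) = - T w"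
    proof -
      have "inverse e - 1 = - (e - 1) / e" "inverse e + 1 = (e + 1) / e" if "e \<noteq> 0" for e :: complex
        using that by (auto simp: field_simps)
      then show ?thesis by (simp add: T_def exp_minus minus_divide_left)
    qed
    ultimately have "T w = 0" using T by (auto simp: complex_nonpos_Reals_iff complex_eq_iff)
    then have "exp w = exp 0" using e1[OF w(1)] by (simp add: T_def)
    moreover have "\<bar>Im w - Im 0\<bar> < 2 * pi"
      using w(1) pi_gt_zero unfolding zero_complex.sel diff_zero by linarith
    ultimately have "w = 0" by (metis exp_complex_eqI)
    with w(3) show False by simp
  qed
  have dG: "(G has_field_derivative exp (\<i> * c * w) / sinh w) (at w)"
    if w: "\<bar>Im w\<bar> \<le> pi / 2" "Re w \<ge> 0" "w \<noteq> 0" for w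
  proof -
    have Im: "\<bar>Im w\<bar> < pi" using w(1) pi_gt_zero by linarith
    have s0: "sinh w \<noteq> 0" using sinh_eq_0_iff_strip[OF Im] w(3) by simp
    have T0: "T w \<noteq> 0" using T_nonpos[OF w] by auto
    then have em: "exp w - 1 \<noteq> 0" by (auto simp: T_def)
    have dT: "(T has_field_derivative 2 * exp w / (exp w + 1)\<^sup>2) (at w)"
      unfolding T_def[abs_def] using e1[OF w(1)]
      by (auto intro!: derivative_eq_intros simp: power2_eq_square algebra_simps)
    have "(G has_field_derivative inverse (T w) * (2 * exp w / (exp w + 1)\<^sup>2) + K w) (at w)"
      unfolding G_def[abs_def]
      by (intro DERIV_add DERIV_chain2[OF has_field_derivative_Ln[OF T_nonpos[OF w]] dT] dH[OF Im])
    also have "inverse (T w) * (2 * exp w / (exp w + 1)\<^sup>2) = 1 / sinh w"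
    proof -
      have gen: "inverse (a / b) * (2 * e / b\<^sup>2) = 2 * e / (a * b)" if "a \<noteq> 0" "b \<noteq> 0" for a b e :: complex
        using that by (simp add: field_simps power2_eq_square)
      have "e - inverse e = (e - 1) * (e + 1) / e" if "e \<noteq> 0" for e :: complex
        using that by (simp add: field_simps)
      then have "sinh w = (exp w - 1) * (exp w + 1) / exp w / 2"
        by (simp add: sinh_field_def exp_minus)
      then have "1 / sinh w = 2 * exp w / ((exp w - 1) * (exp w + 1))" by simp
      then show ?thesis unfolding T_def gen[OF em e1[OF w(1)]] by simp
    qed
    also have "1 / sinh w + K w = exp (\<i> * c * w) / sinh w"
      using w(3) by (simp add: K_def diff_divide_distrib)
    finally show ?thesis .
  qed

  \<comment> \<open>s = 1 and s = - 1 give the boundary lines Im w = pi / 2 and Im w = - pi / 2. The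
    lower one is where |p| takes its large value exp x, so the argument moves fastest there.\<close>
  define \<gamma> where "\<gamma> s u = Complex u (s * pi / 2)" for s u
  define Y where "Y s u = Im (G (\<gamma> s u))" for s u
  have dY: "(Y s has_real_derivative - (s * (exp (- s * x) * cos (c * u) / cosh u))) (at u)"
    if s: "s = 1 \<or> s = - 1" and u: "u \<ge> 0" for s u
  proof -
    have \<gamma>: "\<gamma> s = (\<lambda>u. of_real u + \<i> * (s * pi / 2))"
      by (auto simp: \<gamma>_def complex_eq_iff fun_eq_iff)
    have "(G has_field_derivative exp (\<i> * c * \<gamma> s u) / sinh (\<gamma> s u)) (at (\<gamma> s u))"
      using s u by (intro dG) (auto simp: \<gamma>_def complex_eq_iff)
    moreover have "(\<gamma> s has_vector_derivative 1) (at u)"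
      unfolding \<gamma> by (auto intro!: derivative_eq_intros)
    ultimately have "((\<lambda>u. G (\<gamma> s u)) has_vector_derivative exp (\<i> * c * \<gamma> s u) / sinh (\<gamma> s u)) (at u)"
      using field_vector_diff_chain_at[of "\<gamma> s" 1 u G] by (simp add: o_def)
    from bounded_linear.has_vector_derivative[OF bounded_linear_Im this]
    have "(Y s has_real_derivative Im (exp (\<i> * c * \<gamma> s u) / sinh (\<gamma> s u))) (at u)"
      unfolding Y_def[abs_def] has_real_derivative_iff_has_vector_derivative .
    also have "sinh (\<gamma> s u) = \<i> * s * cosh u"
      using s by (auto simp: sinh_field_def cosh_field_def complex_eq_iff Re_exp Im_exp \<gamma>_def)
    also have "exp (\<i> * c * \<gamma> s u) = exp (- s * x) * cis (c * u)"
      by (auto simp: complex_eq_iff Re_exp Im_exp \<gamma>_def x_def algebra_simps)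
    also have "Im (exp (- s * x) * cis (c * u) / (\<i> * s * cosh u)) = - (s * (exp (- s * x) * cos (c * u) / cosh u))"
      using s by (auto simp: Im_divide power2_eq_square field_simps)
    finally show ?thesis .
  qed
  \<comment> \<open>The point is purely imaginary, hence fixed by the reflection, so
    \<open>H\<close> is real there; only the argument of \<open>T\<close> = i or - i
    contributes.\<close>
  have Y0: "Y s 0 = s * pi / 2" if s: "s = 1 \<or> s = - 1" for s
  proof -
    have "H (- cnj (\<gamma> s 0)) = cnj (H (\<gamma> s 0))"
      using s by (intro Hsym) (auto simp: \<gamma>_def)
    also have "- cnj (\<gamma> s 0) = \<gamma> s 0" by (simp add: \<gamma>_def complex_eq_iff)
    finally have "Im (H (\<gamma> s 0)) = 0" by (metis Im_complex_of_real Reals_cnj_iff complex_is_Real_iff)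
    moreover have "T (\<gamma> s 0) = \<i> * s"
      using s e1[of "\<gamma> s 0"] by (auto simp: T_def \<gamma>_def complex_eq_iff Re_exp Im_exp Re_divide Im_divide)
    ultimately show ?thesis using s by (auto simp: Y_def G_def)
  qed
  \<comment> \<open>G' is integrated across the vertical segment Re w = u of length pi, on which
    |exp (i c w)| \<le> exp x and |sinh w| \<ge> sinh u.\<close>
  have gap: "\<bar>Y 1 u - Y (- 1) u\<bar> \<le> pi * exp x / sinh u" if u: "u > 0" for u
  proof -
    define S where "S = {w. Re w = u \<and> \<bar>Im w\<bar> \<le> pi / 2}"
    have S_eq: "S = {w. Re w \<le> u} \<inter> {w. Re w \<ge> u} \<inter> {w. Im w \<le> pi / 2} \<inter> {w. Im w \<ge> - (pi / 2)}" by (auto simp: S_def)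
    have "convex S" unfolding S_eq
      by (intro convex_Int convex_halfspace_Im_le convex_halfspace_Im_ge convex_halfspace_Re_le convex_halfspace_Re_ge)
    have "norm (G (\<gamma> 1 u) - G (\<gamma> (- 1) u)) \<le> exp x / sinh u * norm (\<gamma> 1 u - \<gamma> (- 1) u)"
    proof (rule field_differentiable_bound[OF \<open>convex S\<close>])
      fix w assume w: "w \<in> S"
      show "(G has_field_derivative exp (\<i> * c * w) / sinh w) (at w within S)"
        using w u by (intro has_field_derivative_at_within[OF dG]) (auto simp: S_def)
      have "- (c * Im w) \<le> x"
        using w mult_left_mono[of "- Im w" "pi / 2" c] by (auto simp: S_def x_def c_def abs_le_iff)
      then have n: "norm (exp (\<i> * c * w)) \<le> exp x" by simp
      have "sinh u \<le> norm (sinh w)"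
        using norm_triangle_ineq2[of "exp w" "exp (- w)"] w
        by (simp add: sinh_field_def norm_divide S_def)
      then show "norm (exp (\<i> * c * w) / sinh w) \<le> exp x / sinh u"
        unfolding norm_divide using u n by (intro frac_le) auto
    qed (auto simp: S_def \<gamma>_def)
    also have "\<gamma> 1 u - \<gamma> (- 1) u = \<i> * pi" by (simp add: \<gamma>_def complex_eq_iff)
    finally show ?thesis
      using abs_Im_le_cmod[of "G (\<gamma> 1 u) - G (\<gamma> (- 1) u)"]
      by (simp add: Y_def norm_mult mult.commute)
  qed
  have cU: "c * U = pi / 2" by (simp add: c_def U_def)
  have U0: "U > 0" by (simp add: U_def c_def)
  have YU: "Y (- 1) U > pi / 2"
  proof (rule boundary_argument_exceeds[where Y\<^sub>1 = "Y 1" and Y\<^sub>2 = "Y (- 1)" and c = c and x = x and U = U])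
    show "pi * exp (- 2 * x) < 4 * cosh x * (c * exp (- U) / (1 + c\<^sup>2) - exp (- 3 * U) / 3)"
      using boundary_numeric_bound by (simp add: c_def x_def U_def)
  qed (use dY[of 1] dY[of "- 1"] Y0[of 1] Y0[of "- 1"] gap U0 cU in \<open>auto simp: c_def\<close>)

  \<comment> \<open>\<open>T\<close> maps this half-strip into the right half of the disc. It is
    connected, so the value pi / 2 of Im G is attained between an interior point near w = 0 and one
    near the boundary point found above, and hence off the imaginary axis.\<close>
  define P where "P = {w. Re w > 0 \<and> \<bar>Im w\<bar> < pi / 2}"
  have P_eq: "P = {w. Re w > 0} \<inter> {w. \<bar>Im w\<bar> < pi / 2}" by (auto simp: P_def)
  have "convex P" unfolding P_eq by (intro convex_Int convex_strip convex_halfspace_Re_gt)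
  have contG: "isCont G w" if "\<bar>Im w\<bar> \<le> pi / 2" "Re w \<ge> 0" "w \<noteq> 0" for w
    using dG[OF that] by (rule DERIV_isCont)
  have "isCont G w" if "w \<in> P" for w
    using that by (intro contG) (auto simp: P_def)
  then have "continuous_on P G" by (simp add: continuous_at_imp_continuous_on)
  then have conn: "connected ((\<lambda>w. Im (G w)) ` P)"
    by (rule connected_continuous_image[OF continuous_on_Im convex_connected[OF \<open>convex P\<close>]])
  obtain w\<^sub>a where wa: "w\<^sub>a \<in> P" "Im (G w\<^sub>a) \<le> pi / 2"
  \<comment> \<open>On the positive real axis \<open>T\<close> is positive and contributes no
    argument, while \<open>H\<close> is small near its zero.\<close>
  proof -
    have "isCont H 0" using dH[of 0] by (intro DERIV_isCont) auto
    then obtain d where d: "d > 0" "\<And>w. dist w 0 < d \<Longrightarrow> dist (H w) 0 < 1"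
      unfolding continuous_at_eps_delta H0 by (metis zero_less_one)
    define t where "t = d / 2"
    have t: "t > 0" "dist (of_real t) (0::complex) < d" using d by (auto simp: t_def)
    have "T (of_real t) = of_real ((exp t - 1) / (exp t + 1))"
      by (simp add: T_def exp_of_real)
    moreover have "(exp t - 1) / (exp t + 1) > 0" using t by (simp add: add_pos_pos)
    ultimately have "Im (Ln (T (of_real t))) = 0" by (simp only: Ln_of_real Im_complex_of_real)
    then have "Im (G (of_real t)) = Im (H (of_real t))" by (simp add: G_def)
    also have "\<dots> \<le> norm (H (of_real t))" by (rule order.trans[OF abs_ge_self abs_Im_le_cmod])
    also have "\<dots> < 1" using d(2)[OF t(2)] by simp
    also have "1 < pi / 2" using pi_gt3 by simp
    finally show ?thesis using t by (intro that[of "of_real t"]) (auto simp: P_def)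
  qed
  obtain w\<^sub>b where wb: "w\<^sub>b \<in> P" "pi / 2 \<le> Im (G w\<^sub>b)"
  proof -
    have "isCont G (\<gamma> (- 1) U)" using U0 by (intro contG) (auto simp: \<gamma>_def complex_eq_iff)
    then have "isCont (\<lambda>w. Im (G w)) (\<gamma> (- 1) U)" by (rule isCont_Im)
    then obtain d where d: "d > 0" "\<And>w. dist w (\<gamma> (- 1) U) < d \<Longrightarrow> dist (Im (G w)) (Y (- 1) U) < Y (- 1) U - pi / 2"
      unfolding continuous_at_eps_delta using YU by (metis Y_def diff_gt_0_iff_gt)
    define t where "t = min (d / 2) (pi / 4)"
    have "t \<le> d / 2" "t \<le> pi / 4" by (simp_all add: t_def)
    moreover have "t > 0" using d(1) by (simp add: t_def)
    ultimately have t: "t > 0" "t < d" "t < pi / 2" using d(1) pi_gt_zero by linarith+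
    have "dist (\<gamma> (- 1) U + \<i> * t) (\<gamma> (- 1) U) < d" using t by (simp add: dist_norm norm_mult)
    from d(2)[OF this] have "pi / 2 \<le> Im (G (\<gamma> (- 1) U + \<i> * t))" by (simp add: dist_real_def)
    then show ?thesis using t U0 by (intro that) (auto simp: P_def \<gamma>_def)
  qed
  have "pi / 2 \<in> (\<lambda>w. Im (G w)) ` P"
    using connectedD_interval[OF conn _ _ wa(2) wb(2)] wa(1) wb(1) by blast
  then obtain w where w: "w \<in> P" "Im (G w) = pi / 2" by auto
  have w': "\<bar>Im w\<bar> \<le> pi / 2" "Re w > 0" "\<bar>Im w\<bar> < pi / 2" using w(1) by (auto simp: P_def)
  define z where "z = T w"
  have z: "norm z < 1"
  proof -
    have "Re (exp w) > 0" using w'(3) by (auto simp: Re_exp abs_less_iff intro!: mult_pos_pos cos_gt_zero_pi)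
    then have "(norm (exp w - 1))\<^sup>2 < (norm (exp w + 1))\<^sup>2"
      unfolding cmod_power2 by (simp add: power2_eq_square algebra_simps)
    then have "norm (exp w - 1) < norm (exp w + 1)" by (rule power_less_imp_less_base) simp
    then show ?thesis using e1[OF w'(1)] by (simp add: z_def T_def norm_divide)
  qed
  have "(1 + z) / (1 - z) = exp w"
  proof -
    have "1 + (e - 1) / (e + 1) = 2 * e / (e + 1)" "1 - (e - 1) / (e + 1) = 2 / (e + 1)"
      if "e + 1 \<noteq> 0" for e :: complex
      using that by (simp_all add: field_simps)
    then show ?thesis using e1[OF w'(1)] by (simp add: z_def T_def)
  qed
  then have "L z = w" using w'(3) pi_gt_zero by (simp add: L_def)
  moreover have "z \<noteq> 0" using ReT[OF w'(1)] w'(2) by (auto simp: z_def)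
  ultimately have "f z = exp (G w)"
    by (simp add: f_def G_def exp_add z_def)
  then have "Re (f z) = 0" by (simp only: Re_exp w(2) cos_pi_half mult_zero_right)
  then have "f (- cnj z) = f z" using fsym[OF z] by (simp add: complex_eq_iff)
  then have "- cnj z = z" by (rule inj_onD[OF inj]) (use z in auto)
  then have "Re z = 0" by (auto simp: complex_eq_iff)
  then show False using ReT[OF w'(1)] w'(2) by (simp add: z_def)
qed

section \<open>Monotonicity in the width and the bounds for the supremum\<close>

lemma univ_prop_antimono:
  assumes "univ_prop \<delta>" "\<delta>' \<le> \<delta>" shows "univ_prop \<delta>'"
  unfolding univ_prop_def
proof (intro allI impI)
  fix f assume "classA f \<and> (\<forall>z\<in>ball 0 1. (z \<noteq> 0 \<longrightarrow> f z \<noteq> 0) \<and>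
               exp (-\<delta>'/2) < norm (zlogderiv f z) \<and> norm (zlogderiv f z) < exp (\<delta>'/2))"
  moreover have "exp (-\<delta>/2) \<le> exp (-\<delta>'/2)" "exp (\<delta>'/2) \<le> exp (\<delta>/2)" using assms(2) by auto
  ultimately show "inj_on f (ball 0 1)"
    using assms(1) unfolding univ_prop_def by (meson order.strict_trans1 order.strict_trans2)
qed

theorem theorem1p1:
  shows "pi / 3 < delta0 \<and> delta0 < 5 * pi / 7"
proof
  define S where "S = {\<delta>. \<delta> > 0 \<and> univ_prop \<delta>}"
  have le: "\<delta> \<le> 57 * pi / 80" if "\<delta> \<in> S" for \<delta>
    using that univ_prop_antimono[of \<delta> "57 * pi / 80"] not_univ_prop_57_80_pi
    unfolding S_def by (metis (mono_tags, lifting) linorder_le_cases mem_Collect_eq)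
  have mem: "17 * pi / 50 \<in> S" using univ_prop_17_50_pi by (simp add: S_def)
  have "bdd_above S" by (rule bdd_aboveI[OF le])
  then have "17 * pi / 50 \<le> delta0"
    unfolding delta0_def S_def[symmetric] using mem by (rule cSup_upper[rotated])
  moreover have "pi / 3 < 17 * pi / 50" by simp
  ultimately show "pi / 3 < delta0" by linarith
  have "delta0 \<le> 57 * pi / 80"
    unfolding delta0_def S_def[symmetric] using mem le by (intro cSup_least) auto
  moreover have "57 * pi / 80 < 5 * pi / 7" by simp
  ultimately show "delta0 < 5 * pi / 7" by linarith
qed

end
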